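(* Let $M$ be a 7-dimensional manifold with an arbitrary $G_2^*$ structure $\varphi$, let $\xi$ be a vector field on $M$ with $g_{4,3}(\xi,\xi)=-1$, and let $(\phi,\xi,\eta,g)$ be the almost paracontact metric structure induced by $\varphi$ and $\xi$. Assume that $\xi$ is Killing. Then the component $F^{11}$ of $\nabla\Phi$ vanishes identically if and only if $\xi\lrcorner\nabla_\xi\varphi=0$.
   Context: $G_2^*$ structures: on $\mathbb{R}^7$ with standard basis $e_1,\dots,e_7$ and dual basis $e^1,\dots,e^7$, let $g_{4,3}$ be the metric of signature $(-,-,-,-,+,+,+)$ for which the basis is orthonormal (the first four vectors having square $-1$), and let $\varphi_0=-e^{127}-e^{135}+e^{146}+e^{236}+e^{245}-e^{347}+e^{567}$, where $e^{ijk}=e^i\wedge e^j\wedge e^k$. $G_2^*$ is the stabilizer of $\varphi_0$ in $GL(7,\mathbb{R})$; it preserves $g_{4,3}$. A $G_2^*$ structure on a smooth oriented 7-manifold $M$ is a smooth 3-form $\varphi$ such that $(T_pM,\varphi_p)$ is isomorphic to $(\mathbb{R}^7,\varphi_0)$ for every $p\in M$. It induces a semi-Riemannian metric, also denoted $g_{4,3}$ (transported pointwise through these isomorphisms), and a cross product $P$ defined by $\varphi(X,Y,Z)=g_{4,3}(P(X,Y),Z)$. Induced almost paracontact metric structure: given a vector field $\xi$ with $g_{4,3}(\xi,\xi)=-1$, set $\phi(X)=P(\xi,X)$, $g=-g_{4,3}$, $\eta(X)=g(\xi,X)$. Then $\phi^2=I-\eta\otimes\xi$, $\eta(\xi)=1$,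 $g(\phi X,\phi Y)=-g(X,Y)+\eta(X)\eta(Y)$. The metrics $g$ and $g_{4,3}$ have the same Levi-Civita connection $\nabla$. The fundamental 2-form is $\Phi(X,Y)=g(\phi X,Y)$ and $F(X,Y,Z)=(\nabla_X\Phi)(Y,Z)$. $\xi$ is Killing if $g(\nabla_X\xi,Y)=-g(\nabla_Y\xi,X)$ for all $X,Y$. The component (projection) of $F$ on the class $\mathbb{G}_{11}$ of the classification of almost paracontact metric structures is $$F^{11}(X,Y,Z)=\eta(X)F(\xi,\phi^2Y,\phi^2Z).$$ The condition $\xi\lrcorner\nabla_\xi\varphi=0$ means $(\nabla_\xi\varphi)(\xi,Y,Z)=0$ for all vector fields $Y,Z$. *)

theory Defs
  imports "HOL-Analysis.Analysis"
begin

section \<open>The model space\<close>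

type_synonym R7 = "real ^ 7"

text \<open>The indices 1, ..., 7 are numerals of the seven-element type \<open>7\<close>; in particular
  \<open>7 = 0\<close> there, and the seven numerals are pairwise distinct.
  The wedge product of 1-forms is normalised as a determinant, without a factor 1/3!.\<close>

definition wedge3 :: "7 \<Rightarrow> 7 \<Rightarrow> 7 \<Rightarrow> R7 \<Rightarrow> R7 \<Rightarrow> R7 \<Rightarrow> real" where
  "wedge3 i j k u v w =
     u$i * (v$j * w$k - v$k * w$j)
   - u$j * (v$i * w$k - v$k * w$i)
   + u$k * (v$i * w$j - v$j * w$i)"

definition phi0 :: "R7 \<Rightarrow> R7 \<Rightarrow> R7 \<Rightarrow> real" where
  "phi0 u v w =
     - wedge3 1 2 7 u v w - wedge3 1 3 5 u v w + wedge3 1 4 6 u v w + wedge3 2 3 6 u v w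
     + wedge3 2 4 5 u v w - wedge3 3 4 7 u v w + wedge3 5 6 7 u v w"

definition metric0 :: "R7 \<Rightarrow> R7 \<Rightarrow> real" where
  "metric0 u v = - u$1 * v$1 - u$2 * v$2 - u$3 * v$3 - u$4 * v$4
                 + u$5 * v$5 + u$6 * v$6 + u$7 * v$7"

definition alternating_trilinear :: "(R7 \<Rightarrow> R7 \<Rightarrow> R7 \<Rightarrow> real) \<Rightarrow> bool" where
  "alternating_trilinear T \<longleftrightarrow>
     (\<forall>v w. linear (\<lambda>u. T u v w)) \<and> (\<forall>u w. linear (\<lambda>v. T u v w)) \<and> (\<forall>u v. linear (T u v)) \<and>
     (\<forall>u v w. T v u w = - T u v w) \<and> (\<forall>u v w. T u w v = - T u v w)"

definition g2star_frame :: "(R7 \<Rightarrow> R7 \<Rightarrow> R7 \<Rightarrow> real) \<Rightarrow> (R7 \<Rightarrow> R7) \<Rightarrow> bool" where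
  "g2star_frame T L \<longleftrightarrow> linear L \<and> bij L \<and> (\<forall>u v w. T u v w = phi0 (L u) (L v) (L w))"

section \<open>Smooth manifolds of dimension 7\<close>

text \<open>\<open>C^k\<close> and \<open>C^\<infinity>\<close> functions on a set \<open>S\<close>, which is always open below.\<close>

primrec Ck_on :: "nat \<Rightarrow> 'a::euclidean_space set \<Rightarrow> ('a \<Rightarrow> 'b::real_normed_vector) \<Rightarrow> bool" where
  "Ck_on 0 S f \<longleftrightarrow> continuous_on S f"
| "Ck_on (Suc k) S f \<longleftrightarrow>
     (\<forall>x\<in>S. f differentiable (at x)) \<and>
     (\<forall>i\<in>Basis. Ck_on k S (\<lambda>x. frechet_derivative f (at x) i))"

definition smooth_on :: "'a::euclidean_space set \<Rightarrow> ('a \<Rightarrow> 'b::real_normed_vector) \<Rightarrow> bool" where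
  "smooth_on S f \<longleftrightarrow> (\<forall>k. Ck_on k S f)"

text \<open>The points of the manifold are the elements of a topological type \<open>'m\<close>, and the smooth
  structure is given by an atlas, not necessarily a maximal one.\<close>

type_synonym 'm chart = "'m set \<times> ('m \<Rightarrow> R7)"

abbreviation chart_dom :: "'m chart \<Rightarrow> 'm set" where
  "chart_dom \<equiv> fst"

abbreviation chart_map :: "'m chart \<Rightarrow> 'm \<Rightarrow> R7" where
  "chart_map \<equiv> snd"

definition chart_img :: "'m chart \<Rightarrow> R7 set" where
  "chart_img c = chart_map c ` chart_dom c"

definition chart_inv :: "'m chart \<Rightarrow> R7 \<Rightarrow> 'm" where
  "chart_inv c = inv_into (chart_dom c) (chart_map c)"

text \<open>\<open>chart_change c d p\<close> is the differential at \<open>p\<close> of the coordinate change from \<open>c\<close> to \<open>d\<close>: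
  it sends the components of a tangent vector at \<open>p\<close> with respect to \<open>c\<close> to its components with
  respect to \<open>d\<close>.\<close>

definition chart_change :: "'m chart \<Rightarrow> 'm chart \<Rightarrow> 'm \<Rightarrow> R7 \<Rightarrow> R7" where
  "chart_change c d p =
     frechet_derivative (chart_map d \<circ> chart_inv c) (at (chart_map c p))"

definition smooth_atlas :: "'m::topological_space chart set \<Rightarrow> bool" where
  "smooth_atlas A \<longleftrightarrow>
     (\<Union>c\<in>A. chart_dom c) = UNIV \<and>
     (\<forall>c\<in>A. open (chart_dom c) \<and> open (chart_img c) \<and>
        homeomorphism (chart_dom c) (chart_img c) (chart_map c) (chart_inv c)) \<and>
     (\<forall>c\<in>A. \<forall>d\<in>A. smooth_on (chart_map c ` (chart_dom c \<inter> chart_dom d))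
        (chart_map d \<circ> chart_inv c))"

definition oriented_atlas :: "'m chart set \<Rightarrow> bool" where
  "oriented_atlas A \<longleftrightarrow>
     (\<forall>c\<in>A. \<forall>d\<in>A. \<forall>p \<in> chart_dom c \<inter> chart_dom d. det (matrix (chart_change c d p)) > 0)"

text \<open>The tangent space at \<open>p\<close> is modelled on \<open>R7\<close>: a tangent vector at \<open>p\<close> is represented by its
  components with respect to a chart \<open>chart_at A p\<close> chosen once and for all for every point.
  The choice may jump from point to point, so a vector field, being a map \<open>'m \<Rightarrow> R7\<close>,
  must be converted to the components of a fixed chart before its smoothness is tested.
  Likewise a field of bilinear or trilinear forms is a function of a point and of tangent
  vectors at this point.\<close>

definition chart_at :: "'m chart set \<Rightarrow> 'm \<Rightarrow> 'm chart" where
  "chart_at A p = (SOME c. c \<in> A \<and> p \<in> chart_dom c)"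

definition smooth_function :: "'m chart set \<Rightarrow> ('m \<Rightarrow> real) \<Rightarrow> bool" where
  "smooth_function A f \<longleftrightarrow> (\<forall>c\<in>A. smooth_on (chart_img c) (f \<circ> chart_inv c))"

definition smooth_field :: "'m chart set \<Rightarrow> ('m \<Rightarrow> R7) \<Rightarrow> bool" where
  "smooth_field A X \<longleftrightarrow>
     (\<forall>c\<in>A. smooth_on (chart_img c)
        ((\<lambda>p. chart_change (chart_at A p) c p (X p)) \<circ> chart_inv c))"

text \<open>For constant \<open>a\<close>, the vectors \<open>chart_change c (chart_at A p) p a\<close> form the field on the domain
  of \<open>c\<close> with constant components \<open>a\<close>, so the functions required to be smooth here are the
  components of the 3-form in the chart \<open>c\<close>.\<close>

definition smooth_3form :: "'m chart set \<Rightarrow> ('m \<Rightarrow> R7 \<Rightarrow> R7 \<Rightarrow> R7 \<Rightarrow> real) \<Rightarrow> bool" where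
  "smooth_3form A \<phi> \<longleftrightarrow>
     (\<forall>p. alternating_trilinear (\<phi> p)) \<and>
     (\<forall>c\<in>A. \<forall>a b e. smooth_on (chart_img c)
        ((\<lambda>p. \<phi> p (chart_change c (chart_at A p) p a)
                   (chart_change c (chart_at A p) p b)
                   (chart_change c (chart_at A p) p e)) \<circ> chart_inv c))"

definition field_deriv :: "'m chart set \<Rightarrow> ('m \<Rightarrow> R7) \<Rightarrow> ('m \<Rightarrow> real) \<Rightarrow> 'm \<Rightarrow> real" where
  "field_deriv A X f p =
     frechet_derivative (f \<circ> chart_inv (chart_at A p)) (at (chart_map (chart_at A p) p)) (X p)"

definition lie_bracket_is ::
    "'m chart set \<Rightarrow> ('m \<Rightarrow> R7) \<Rightarrow> ('m \<Rightarrow> R7) \<Rightarrow> ('m \<Rightarrow> R7) \<Rightarrow> bool" where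
  "lie_bracket_is A X Y W \<longleftrightarrow>
     smooth_field A W \<and>
     (\<forall>f. smooth_function A f \<longrightarrow> (\<forall>p.
        field_deriv A W f p =
        field_deriv A X (field_deriv A Y f) p - field_deriv A Y (field_deriv A X f) p))"

section \<open>Connections\<close>

text \<open>A connection is only meaningful on smooth vector fields; its values on other
  maps are unconstrained.\<close>

definition affine_connection ::
    "'m chart set \<Rightarrow> (('m \<Rightarrow> R7) \<Rightarrow> ('m \<Rightarrow> R7) \<Rightarrow> 'm \<Rightarrow> R7) \<Rightarrow> bool" where
  "affine_connection A nabla \<longleftrightarrow>
     (\<forall>X Y. smooth_field A X \<and> smooth_field A Y \<longrightarrow> smooth_field A (nabla X Y)) \<and>
     (\<forall>X Y Z. smooth_field A X \<and> smooth_field A Y \<and> smooth_field A Z \<longrightarrow> (\<forall>p.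
        nabla (\<lambda>q. X q + Y q) Z p = nabla X Z p + nabla Y Z p \<and>
        nabla X (\<lambda>q. Y q + Z q) p = nabla X Y p + nabla X Z p)) \<and>
     (\<forall>f X Y. smooth_function A f \<and> smooth_field A X \<and> smooth_field A Y \<longrightarrow> (\<forall>p.
        nabla (\<lambda>q. f q *\<^sub>R X q) Y p = f p *\<^sub>R nabla X Y p \<and>
        nabla X (\<lambda>q. f q *\<^sub>R Y q) p = field_deriv A X f p *\<^sub>R Y p + f p *\<^sub>R nabla X Y p))"

definition levi_civita_connection ::
    "'m chart set \<Rightarrow> ('m \<Rightarrow> R7 \<Rightarrow> R7 \<Rightarrow> real) \<Rightarrow> (('m \<Rightarrow> R7) \<Rightarrow> ('m \<Rightarrow> R7) \<Rightarrow> 'm \<Rightarrow> R7) \<Rightarrow> bool" where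
  "levi_civita_connection A g nabla \<longleftrightarrow>
     affine_connection A nabla \<and>
     (\<forall>X Y. smooth_field A X \<and> smooth_field A Y \<longrightarrow>
        lie_bracket_is A X Y (\<lambda>p. nabla X Y p - nabla Y X p)) \<and>
     (\<forall>X Y Z. smooth_field A X \<and> smooth_field A Y \<and> smooth_field A Z \<longrightarrow> (\<forall>p.
        field_deriv A X (\<lambda>q. g q (Y q) (Z q)) p =
        g p (nabla X Y p) (Z p) + g p (Y p) (nabla X Z p)))"

definition killing_field ::
    "'m chart set \<Rightarrow> ('m \<Rightarrow> R7 \<Rightarrow> R7 \<Rightarrow> real) \<Rightarrow> (('m \<Rightarrow> R7) \<Rightarrow> ('m \<Rightarrow> R7) \<Rightarrow> 'm \<Rightarrow> R7) \<Rightarrow>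
     ('m \<Rightarrow> R7) \<Rightarrow> bool" where
  "killing_field A g nabla \<xi> \<longleftrightarrow>
     (\<forall>X Y. smooth_field A X \<and> smooth_field A Y \<longrightarrow> (\<forall>p.
        g p (nabla X \<xi> p) (Y p) = - g p (nabla Y \<xi> p) (X p)))"

definition cov_deriv2 ::
    "'m chart set \<Rightarrow> (('m \<Rightarrow> R7) \<Rightarrow> ('m \<Rightarrow> R7) \<Rightarrow> 'm \<Rightarrow> R7) \<Rightarrow> ('m \<Rightarrow> R7 \<Rightarrow> R7 \<Rightarrow> real) \<Rightarrow>
     ('m \<Rightarrow> R7) \<Rightarrow> ('m \<Rightarrow> R7) \<Rightarrow> ('m \<Rightarrow> R7) \<Rightarrow> 'm \<Rightarrow> real" where
  "cov_deriv2 A nabla T X Y Z p =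
     field_deriv A X (\<lambda>q. T q (Y q) (Z q)) p
     - T p (nabla X Y p) (Z p) - T p (Y p) (nabla X Z p)"

definition cov_deriv3 ::
    "'m chart set \<Rightarrow> (('m \<Rightarrow> R7) \<Rightarrow> ('m \<Rightarrow> R7) \<Rightarrow> 'm \<Rightarrow> R7) \<Rightarrow> ('m \<Rightarrow> R7 \<Rightarrow> R7 \<Rightarrow> R7 \<Rightarrow> real) \<Rightarrow>
     ('m \<Rightarrow> R7) \<Rightarrow> ('m \<Rightarrow> R7) \<Rightarrow> ('m \<Rightarrow> R7) \<Rightarrow> ('m \<Rightarrow> R7) \<Rightarrow> 'm \<Rightarrow> real" where
  "cov_deriv3 A nabla T X U Y Z p =
     field_deriv A X (\<lambda>q. T q (U q) (Y q) (Z q)) p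
     - T p (nabla X U p) (Y p) (Z p) - T p (U p) (nabla X Y p) (Z p)
     - T p (U p) (Y p) (nabla X Z p)"

section \<open>Structures of type \<open>G\<^sub>2\<^sup>*\<close> and induced almost paracontact metric structures\<close>

definition g2star_structure ::
    "'m chart set \<Rightarrow> ('m \<Rightarrow> R7 \<Rightarrow> R7 \<Rightarrow> R7 \<Rightarrow> real) \<Rightarrow> bool" where
  "g2star_structure A \<phi> \<longleftrightarrow> smooth_3form A \<phi> \<and> (\<forall>p. \<exists>L. g2star_frame (\<phi> p) L)"

text \<open>Two frames adapted to the same 3-form differ by an element of the stabiliser of \<open>phi0\<close>,
  which preserves \<open>metric0\<close>; hence the choice of the frame is irrelevant.\<close>

definition g43 :: "('m \<Rightarrow> R7 \<Rightarrow> R7 \<Rightarrow> R7 \<Rightarrow> real) \<Rightarrow> 'm \<Rightarrow> R7 \<Rightarrow> R7 \<Rightarrow> real" where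
  "g43 \<phi> p u v = (let L = (SOME L. g2star_frame (\<phi> p) L) in metric0 (L u) (L v))"

definition cross_product :: "('m \<Rightarrow> R7 \<Rightarrow> R7 \<Rightarrow> R7 \<Rightarrow> real) \<Rightarrow> 'm \<Rightarrow> R7 \<Rightarrow> R7 \<Rightarrow> R7" where
  "cross_product \<phi> p u v = (THE w. \<forall>z. \<phi> p u v z = g43 \<phi> p w z)"

definition pc_endo ::
    "('m \<Rightarrow> R7 \<Rightarrow> R7 \<Rightarrow> R7 \<Rightarrow> real) \<Rightarrow> ('m \<Rightarrow> R7) \<Rightarrow> 'm \<Rightarrow> R7 \<Rightarrow> R7" where
  "pc_endo \<phi> \<xi> p u = cross_product \<phi> p (\<xi> p) u"

definition pc_metric :: "('m \<Rightarrow> R7 \<Rightarrow> R7 \<Rightarrow> R7 \<Rightarrow> real) \<Rightarrow> 'm \<Rightarrow> R7 \<Rightarrow> R7 \<Rightarrow> real" where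
  "pc_metric \<phi> p u v = - g43 \<phi> p u v"

definition pc_eta ::
    "('m \<Rightarrow> R7 \<Rightarrow> R7 \<Rightarrow> R7 \<Rightarrow> real) \<Rightarrow> ('m \<Rightarrow> R7) \<Rightarrow> 'm \<Rightarrow> R7 \<Rightarrow> real" where
  "pc_eta \<phi> \<xi> p u = pc_metric \<phi> p (\<xi> p) u"

definition fundamental_2form ::
    "('m \<Rightarrow> R7 \<Rightarrow> R7 \<Rightarrow> R7 \<Rightarrow> real) \<Rightarrow> ('m \<Rightarrow> R7) \<Rightarrow> 'm \<Rightarrow> R7 \<Rightarrow> R7 \<Rightarrow> real" where
  "fundamental_2form \<phi> \<xi> p u v = pc_metric \<phi> p (pc_endo \<phi> \<xi> p u) v"

definition F_tensor ::
    "'m chart set \<Rightarrow> (('m \<Rightarrow> R7) \<Rightarrow> ('m \<Rightarrow> R7) \<Rightarrow> 'm \<Rightarrow> R7) \<Rightarrow>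
     ('m \<Rightarrow> R7 \<Rightarrow> R7 \<Rightarrow> R7 \<Rightarrow> real) \<Rightarrow> ('m \<Rightarrow> R7) \<Rightarrow>
     ('m \<Rightarrow> R7) \<Rightarrow> ('m \<Rightarrow> R7) \<Rightarrow> ('m \<Rightarrow> R7) \<Rightarrow> 'm \<Rightarrow> real" where
  "F_tensor A nabla \<phi> \<xi> X Y Z = cov_deriv2 A nabla (fundamental_2form \<phi> \<xi>) X Y Z"

definition F11 ::
    "'m chart set \<Rightarrow> (('m \<Rightarrow> R7) \<Rightarrow> ('m \<Rightarrow> R7) \<Rightarrow> 'm \<Rightarrow> R7) \<Rightarrow>
     ('m \<Rightarrow> R7 \<Rightarrow> R7 \<Rightarrow> R7 \<Rightarrow> real) \<Rightarrow> ('m \<Rightarrow> R7) \<Rightarrow>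
     ('m \<Rightarrow> R7) \<Rightarrow> ('m \<Rightarrow> R7) \<Rightarrow> ('m \<Rightarrow> R7) \<Rightarrow> 'm \<Rightarrow> real" where
  "F11 A nabla \<phi> \<xi> X Y Z p =
     pc_eta \<phi> \<xi> p (X p) *
     F_tensor A nabla \<phi> \<xi> \<xi>
       (\<lambda>q. pc_endo \<phi> \<xi> q (pc_endo \<phi> \<xi> q (Y q)))
       (\<lambda>q. pc_endo \<phi> \<xi> q (pc_endo \<phi> \<xi> q (Z q))) p"

end

theory Submission
  imports Defs
begin

text \<open>
  Since \<open>\<Phi> = - \<phi>(\<xi>, \<cdot>, \<cdot>)\<close>, the tensors \<open>F(\<xi>, Y, Z)\<close> and \<open>- (\<nabla>\<^sub>\<xi>\<phi>)(\<xi>, Y, Z)\<close> differ by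
  \<open>\<phi>(\<nabla>\<^sub>\<xi>\<xi>, Y, Z)\<close>, which vanishes because a Killing field of constant length has geodesic integral
  curves. Replacing \<open>Y\<close> by its horizontal part \<open>Y - \<eta>(Y)\<xi>\<close> changes nothing, as \<open>\<phi>\<close> is alternating. Hence
  \<open>F\<^sup>1\<^sup>1(X, Y, Z) = - \<eta>(X) (\<nabla>\<^sub>\<xi>\<phi>)(\<xi>, Y, Z)\<close>.

  The computation differentiates \<open>\<eta>(Y)\<close> and \<open>P(Y, Z)\<close>, so the metric, which is only defined
  pointwise by a choice of adapted frames, has to be shown to be smooth. With \<open>P\<^sub>u = P(u, \<cdot>)\<close>, the
  operators \<open>P\<^sub>\<xi>P\<^sub>v\<close> are obtained from the coefficients of \<open>\<phi>\<close> by inverting the 2-form \<open>\<phi>(\<xi>, \<cdot>, \<cdot>)\<close>,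
  bordered by the square of a 1-form to remove its kernel, and the metric is recovered from
  \<open>tr(P\<^sub>\<xi>P\<^sub>uP\<^sub>\<xi>P\<^sub>v) = 4 g(u, v) + 10 g(\<xi>, u) g(\<xi>, v)\<close>.
\<close>

section \<open>Smooth functions\<close>

text \<open>\<open>frechet_derivative\<close> chooses among all derivatives at the point. Locally
  equal functions have the same derivatives, so the choices agree even where there is none.\<close>

lemma frechet_derivative_cong_open:
  assumes "open S" "x \<in> S" "\<And>y. y \<in> S \<Longrightarrow> f y = g y"
  shows "frechet_derivative f (at x) = frechet_derivative g (at x)"
proof -
  have "(f has_derivative D) (at x) \<longleftrightarrow> (g has_derivative D) (at x)" for D
    using assms by (metis has_derivative_transform_within_open)
  then show ?thesis
    by (simp add: frechet_derivative_def)
qed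

lemma Ck_on_cong:
  assumes "open S" "\<And>x. x \<in> S \<Longrightarrow> f x = g x"
  shows "Ck_on k S f \<longleftrightarrow> Ck_on k S g"
  using assms(2)
proof (induction k arbitrary: f g)
  case 0
  then show ?case by (simp cong: continuous_on_cong)
next
  case (Suc k)
  have "f differentiable (at x) \<longleftrightarrow> g differentiable (at x)" if "x \<in> S" for x
    unfolding differentiable_def using assms(1) that Suc.prems
    by (metis has_derivative_transform_within_open)
  moreover have "frechet_derivative f (at x) = frechet_derivative g (at x)" if "x \<in> S" for x
    using assms(1) that Suc.prems by (rule frechet_derivative_cong_open)
  then have "Ck_on k S (\<lambda>x. frechet_derivative f (at x) i) \<longleftrightarrow>
      Ck_on k S (\<lambda>x. frechet_derivative g (at x) i)" for i
    by (intro Suc.IH) simp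
  ultimately show ?case by simp
qed

lemma Ck_on_SucD: "Ck_on (Suc k) S f \<Longrightarrow> Ck_on k S f"
proof (induction k arbitrary: f)
  case 0
  then show ?case
    by (auto intro!: continuous_at_imp_continuous_on differentiable_imp_continuous_within)
qed auto

text \<open>Any explicit formula \<open>f'\<close> may stand in for
  \<open>frechet_derivative\<close>, so the inductions below work with the usual rules of
  calculus.\<close>

lemma Ck_on_SucI:
  assumes "open S" "\<And>x. x \<in> S \<Longrightarrow> (f has_derivative f' x) (at x)"
    and "\<And>i. i \<in> Basis \<Longrightarrow> Ck_on k S (\<lambda>x. f' x i)"
  shows "Ck_on (Suc k) S f"
proof -
  have "frechet_derivative f (at x) = f' x" if "x \<in> S" for x
    using frechet_derivative_at[OF assms(2)[OF that]] by simp
  then have "Ck_on k S (\<lambda>x. frechet_derivative f (at x) i)" if "i \<in> Basis" for i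
    using assms(1,3) that by (subst Ck_on_cong[where g="\<lambda>x. f' x i"]) auto
  then show ?thesis
    using assms(2) by (auto simp: differentiable_def)
qed

text \<open>The last conclusion lowers the order of \<open>f\<close> itself: product and quotient
  rules leave undifferentiated factors, to which the induction hypothesis must apply.\<close>

lemma Ck_on_SucE:
  assumes "Ck_on (Suc k) S f"
  obtains f' where "\<And>x. x \<in> S \<Longrightarrow> (f has_derivative f' x) (at x)"
    and "\<And>i. i \<in> Basis \<Longrightarrow> Ck_on k S (\<lambda>x. f' x i)" and "Ck_on k S f"
  using assms Ck_on_SucD[OF assms]
  by (intro that[of "\<lambda>x. frechet_derivative f (at x)"])
    (auto simp: frechet_derivative_works[symmetric])

lemma Ck_on_const: "open S \<Longrightarrow> Ck_on k S (\<lambda>x. a)"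
proof (induction k arbitrary: a)
  case (Suc k)
  then show ?case
    by (intro Ck_on_SucI[where f'="\<lambda>x h. 0"]) auto
qed simp

lemma Ck_on_add:
  assumes "open S" "Ck_on k S f" "Ck_on k S g"
  shows "Ck_on k S (\<lambda>x. f x + g x)"
  using assms(2,3)
proof (induction k arbitrary: f g)
  case 0
  then show ?case by (simp add: continuous_on_add)
next
  case (Suc k)
  from Suc.prems(1) obtain f' where f: "\<And>x. x \<in> S \<Longrightarrow> (f has_derivative f' x) (at x)"
      "\<And>i. i \<in> Basis \<Longrightarrow> Ck_on k S (\<lambda>x. f' x i)"
    by (rule Ck_on_SucE) blast
  from Suc.prems(2) obtain g' where g: "\<And>x. x \<in> S \<Longrightarrow> (g has_derivative g' x) (at x)"
      "\<And>i. i \<in> Basis \<Longrightarrow> Ck_on k S (\<lambda>x. g' x i)"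
    by (rule Ck_on_SucE) blast
  show ?case
    by (rule Ck_on_SucI[where f'="\<lambda>x h. f' x h + g' x h"])
      (auto intro!: assms(1) has_derivative_add f g Suc.IH)
qed

lemma (in bounded_bilinear) Ck_on:
  assumes "open S" "Ck_on k S f" "Ck_on k S g"
  shows "Ck_on k S (\<lambda>x. prod (f x) (g x))"
  using assms(2,3)
proof (induction k arbitrary: f g)
  case 0
  then show ?case by (simp add: continuous_on)
next
  case (Suc k)
  from Suc.prems(1) obtain f' where f: "\<And>x. x \<in> S \<Longrightarrow> (f has_derivative f' x) (at x)"
      "\<And>i. i \<in> Basis \<Longrightarrow> Ck_on k S (\<lambda>x. f' x i)" "Ck_on k S f"
    by (rule Ck_on_SucE) blast
  from Suc.prems(2) obtain g' where g: "\<And>x. x \<in> S \<Longrightarrow> (g has_derivative g' x) (at x)"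
      "\<And>i. i \<in> Basis \<Longrightarrow> Ck_on k S (\<lambda>x. g' x i)" "Ck_on k S g"
    by (rule Ck_on_SucE) blast
  show ?case
    by (rule Ck_on_SucI[where f'="\<lambda>x h. prod (f x) (g' x h) + prod (f' x h) (g x)"])
      (auto intro!: assms(1) FDERIV f g Suc.IH Ck_on_add)
qed

lemma (in bounded_linear) Ck_on:
  assumes "open S" "Ck_on k S g"
  shows "Ck_on k S (\<lambda>x. f (g x))"
  using assms(2)
proof (induction k arbitrary: g)
  case 0
  then show ?case by (simp add: continuous_on)
next
  case (Suc k)
  from Suc.prems obtain g' where g: "\<And>x. x \<in> S \<Longrightarrow> (g has_derivative g' x) (at x)"
      "\<And>i. i \<in> Basis \<Longrightarrow> Ck_on k S (\<lambda>x. g' x i)"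
    by (rule Ck_on_SucE) blast
  show ?case
    by (rule Ck_on_SucI[where f'="\<lambda>x h. f (g' x h)"])
      (auto intro!: assms(1) has_derivative g Suc.IH)
qed

text \<open>Up to sign the derivative is \<open>f'\<close> times two copies of
  \<open>inverse f\<close>, which is of class \<open>Ck_on k\<close> by the induction
  hypothesis.\<close>

lemma Ck_on_inverse:
  fixes f :: "'a::euclidean_space \<Rightarrow> real"
  assumes "open S" "Ck_on k S f" "\<And>x. x \<in> S \<Longrightarrow> f x \<noteq> 0"
  shows "Ck_on k S (\<lambda>x. inverse (f x))"
  using assms(2)
proof (induction k)
  case 0
  then show ?case using assms(3) by (auto intro!: continuous_on_inverse)
next
  case (Suc k)
  from Suc.prems obtain f' where f: "\<And>x. x \<in> S \<Longrightarrow> (f has_derivative f' x) (at x)"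
      "\<And>i. i \<in> Basis \<Longrightarrow> Ck_on k S (\<lambda>x. f' x i)" "Ck_on k S f"
    by (rule Ck_on_SucE) blast
  show ?case
  proof (rule Ck_on_SucI[OF assms(1)])
    show "((\<lambda>x. inverse (f x)) has_derivative (\<lambda>h. - (inverse (f x) * f' x h * inverse (f x)))) (at x)"
      if "x \<in> S" for x
      using assms(3)[OF that] f(1)[OF that] by (rule Deriv.has_derivative_inverse)
    have "Ck_on k S (\<lambda>x. inverse (f x) * f' x i * inverse (f x))" if "i \<in> Basis" for i
      using Suc.IH[OF f(3)] f(2)[OF that]
      by (intro bounded_bilinear.Ck_on[OF bounded_bilinear_mult] assms(1))
    then show "Ck_on k S (\<lambda>x. - (inverse (f x) * f' x i * inverse (f x)))" if "i \<in> Basis" for i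
      using that
      by (intro bounded_linear.Ck_on[OF bounded_linear_minus[OF bounded_linear_ident]] assms(1)) simp
  qed
qed

section \<open>Closure properties of smooth functions\<close>

named_theorems smooth_intros

lemma smooth_on_const [smooth_intros]: "open S \<Longrightarrow> smooth_on S (\<lambda>x. a)"
  by (simp add: smooth_on_def Ck_on_const)

lemma smooth_on_add [smooth_intros]:
  "open S \<Longrightarrow> smooth_on S f \<Longrightarrow> smooth_on S g \<Longrightarrow> smooth_on S (\<lambda>x. f x + g x)"
  by (simp add: smooth_on_def Ck_on_add)

lemma (in bounded_linear) smooth_on:
  "open S \<Longrightarrow> smooth_on S g \<Longrightarrow> smooth_on S (\<lambda>x. f (g x))"
  by (simp add: smooth_on_def Ck_on)

lemma (in bounded_bilinear) smooth_on:
  "open S \<Longrightarrow> smooth_on S f \<Longrightarrow> smooth_on S g \<Longrightarrow> smooth_on S (\<lambda>x. prod (f x) (g x))"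
  by (simp add: smooth_on_def Ck_on)

lemmas smooth_on_minus [smooth_intros] =
  bounded_linear.smooth_on[OF bounded_linear_minus[OF bounded_linear_ident]]
lemmas smooth_on_nth [smooth_intros] = bounded_linear.smooth_on[OF bounded_linear_vec_nth]
lemmas smooth_on_mult [smooth_intros] = bounded_bilinear.smooth_on[OF bounded_bilinear_mult]
lemmas smooth_on_scaleR [smooth_intros] = bounded_bilinear.smooth_on[OF bounded_bilinear_scaleR]

lemma smooth_on_diff [smooth_intros]:
  assumes "open S" "smooth_on S f" "smooth_on S g"
  shows "smooth_on S (\<lambda>x. f x - g x)"
  using smooth_on_add[OF assms(1,2) smooth_on_minus[OF assms(1,3)]] by simp

lemma smooth_on_inverse [smooth_intros]:
  fixes f :: "'a::euclidean_space \<Rightarrow> real"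
  shows "open S \<Longrightarrow> smooth_on S f \<Longrightarrow> (\<And>x. x \<in> S \<Longrightarrow> f x \<noteq> 0) \<Longrightarrow> smooth_on S (\<lambda>x. inverse (f x))"
  by (simp add: smooth_on_def Ck_on_inverse)

lemma smooth_on_divide [smooth_intros]:
  fixes f g :: "'a::euclidean_space \<Rightarrow> real"
  shows "open S \<Longrightarrow> smooth_on S f \<Longrightarrow> smooth_on S g \<Longrightarrow> (\<And>x. x \<in> S \<Longrightarrow> g x \<noteq> 0) \<Longrightarrow>
    smooth_on S (\<lambda>x. f x / g x)"
  by (simp add: divide_inverse smooth_on_mult smooth_on_inverse)

lemma smooth_on_sum [smooth_intros]:
  assumes "open S" "\<And>i. i \<in> I \<Longrightarrow> smooth_on S (f i)"
  shows "smooth_on S (\<lambda>x. \<Sum>i\<in>I. f i x)"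
  using assms(2)
  by (induction I rule: infinite_finite_induct) (simp_all add: smooth_on_const smooth_on_add assms(1))

lemma smooth_on_prod [smooth_intros]:
  fixes f :: "'i \<Rightarrow> 'a::euclidean_space \<Rightarrow> real"
  assumes "open S" "\<And>i. i \<in> I \<Longrightarrow> smooth_on S (f i)"
  shows "smooth_on S (\<lambda>x. \<Prod>i\<in>I. f i x)"
  using assms(2)
  by (induction I rule: infinite_finite_induct) (simp_all add: smooth_on_const smooth_on_mult assms(1))

lemma smooth_on_cong:
  "open S \<Longrightarrow> (\<And>x. x \<in> S \<Longrightarrow> f x = g x) \<Longrightarrow> smooth_on S f \<longleftrightarrow> smooth_on S g"
  unfolding smooth_on_def using Ck_on_cong by blast

lemma smooth_on_imp_differentiable: "smooth_on S f \<Longrightarrow> x \<in> S \<Longrightarrow> f differentiable (at x)"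
  unfolding smooth_on_def by (auto dest: spec[of _ "Suc 0"])

lemma smooth_on_vec [smooth_intros]:
  fixes f :: "'n::finite \<Rightarrow> 'a::euclidean_space \<Rightarrow> real"
  assumes "open S" "\<And>i. smooth_on S (f i)"
  shows "smooth_on S (\<lambda>x. \<chi> i. f i x)"
proof -
  have "(\<lambda>x. \<chi> i. f i x) = (\<lambda>x. \<Sum>i\<in>UNIV. f i x *\<^sub>R axis i 1)"
    by (auto simp: vec_eq_iff axis_def if_distrib cong: if_cong)
  then show ?thesis
    by (simp only:) (intro smooth_on_sum smooth_on_scaleR smooth_on_const assms)
qed

section \<open>Determinants and linear systems with smooth coefficients\<close>

lemma smooth_on_det [smooth_intros]:
  fixes a :: "'a::euclidean_space \<Rightarrow> real ^ 'n ^ 'n"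
  assumes "open S" "\<And>i j. smooth_on S (\<lambda>x. a x $ i $ j)"
  shows "smooth_on S (\<lambda>x. det (a x))"
  unfolding det_def by (intro smooth_on_sum smooth_on_mult smooth_on_prod smooth_on_const assms)

lemma matrix_inv_right:
  fixes a :: "real ^ 'n ^ 'n"
  assumes "invertible a"
  shows "a ** matrix_inv a = mat 1"
proof -
  have "\<exists>a'. a ** a' = mat 1 \<and> a' ** a = mat 1"
    using assms by (simp add: invertible_def)
  from someI_ex[OF this] show ?thesis
    by (simp add: matrix_inv_def)
qed

text \<open>By Cramer's rule each component is a quotient of two determinants, and the denominator
  vanishes nowhere on \<open>S\<close>.\<close>

lemma smooth_on_matrix_inv_mult:
  fixes a :: "'a::euclidean_space \<Rightarrow> real ^ 'n ^ 'n" and b :: "'a \<Rightarrow> real ^ 'n"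
  assumes "open S" "\<And>i j. smooth_on S (\<lambda>x. a x $ i $ j)" "\<And>i. smooth_on S (\<lambda>x. b x $ i)"
    and "\<And>x. x \<in> S \<Longrightarrow> invertible (a x)"
  shows "smooth_on S (\<lambda>x. (matrix_inv (a x) *v b x) $ k)"
proof -
  have det: "det (a x) \<noteq> 0" if "x \<in> S" for x
    using assms(4)[OF that] by (simp add: invertible_det_nz)
  have "(matrix_inv (a x) *v b x) $ k =
      det (\<chi> i j. if j = k then b x $ i else a x $ i $ j) / det (a x)" if "x \<in> S" for x
  proof -
    have "a x *v (matrix_inv (a x) *v b x) = b x"
      using assms(4)[OF that] by (simp add: matrix_vector_mul_assoc matrix_inv_right)
    then show ?thesis
      using cramer[OF det[OF that]] by (simp add: vec_eq_iff)
  qed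
  moreover have "smooth_on S (\<lambda>x. (\<chi> i j. if j = k then b x $ i else a x $ i $ j) $ i $ j)" for i j
    using assms(2,3) by (cases "j = k") simp_all
  then have "smooth_on S (\<lambda>x. det (\<chi> i j. if j = k then b x $ i else a x $ i $ j) / det (a x))"
    by (intro smooth_on_divide smooth_on_det assms det)
  ultimately show ?thesis
    by (subst smooth_on_cong[OF assms(1)])
qed

section \<open>Cross products in dimension seven\<close>

lemma linear_axis_sum:
  fixes f :: "real ^ 'n \<Rightarrow> 'b::real_vector"
  assumes "linear f"
  shows "f x = (\<Sum>i\<in>UNIV. (x $ i) *\<^sub>R f (axis i 1))"
proof -
  have "x = (\<Sum>i\<in>UNIV. (x $ i) *\<^sub>R axis i 1)"
    by (auto simp: vec_eq_iff axis_def if_distrib cong: if_cong)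
  then show ?thesis
    by (metis (no_types, lifting) assms linear_scale linear_sum sum.cong)
qed

lemma exhaust_7:
  fixes x :: 7
  shows "x = 1 \<or> x = 2 \<or> x = 3 \<or> x = 4 \<or> x = 5 \<or> x = 6 \<or> x = 7"
proof (induct x)
  case (of_int z)
  then have "z = 0 \<or> z = 1 \<or> z = 2 \<or> z = 3 \<or> z = 4 \<or> z = 5 \<or> z = 6"
    by fastforce
  then show ?case by auto
qed

lemma forall_7: "(\<forall>i::7. P i) \<longleftrightarrow> P 1 \<and> P 2 \<and> P 3 \<and> P 4 \<and> P 5 \<and> P 6 \<and> P 7"
  by (metis exhaust_7)

section \<open>Traces of operators\<close>

definition tr :: "(real ^ 'n \<Rightarrow> real ^ 'n) \<Rightarrow> real" where
  "tr f = (\<Sum>i\<in>UNIV. f (axis i 1) $ i)"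

lemma tr_add: "tr (\<lambda>x. f x + h x) = tr f + tr h"
  by (simp add: tr_def sum.distrib)

lemma tr_diff: "tr (\<lambda>x. f x - h x) = tr f - tr h"
  by (simp add: tr_def sum_subtractf)

lemma tr_scaleR: "tr (\<lambda>x. a *\<^sub>R f x) = a * tr f"
  by (simp add: tr_def sum_distrib_left)

lemma tr_rank_one:
  fixes b :: "real ^ 'n \<Rightarrow> real"
  assumes "linear b"
  shows "tr (\<lambda>x. b x *\<^sub>R a) = b a"
  using linear_axis_sum[OF assms, of a] by (simp add: tr_def mult.commute)

lemma tr_sum: "tr (\<lambda>x. \<Sum>i\<in>I. f i x) = (\<Sum>i\<in>I. tr (f i))"
  by (simp add: tr_def sum.swap[of _ I])

text \<open>Expanding \<open>f\<close> over its columns makes the composite a sum of rank-one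
  operators, whose traces are given by \<open>tr_rank_one\<close>.\<close>

lemma tr_commute:
  fixes f h :: "real ^ 'n \<Rightarrow> real ^ 'n"
  assumes "linear f" "linear h"
  shows "tr (\<lambda>x. f (h x)) = tr (\<lambda>x. h (f x))"
proof -
  have "(\<lambda>x. f (h x)) = (\<lambda>x. \<Sum>j\<in>UNIV. (h x $ j) *\<^sub>R f (axis j 1))"
    by (rule ext) (rule linear_axis_sum[OF assms(1)])
  then have "tr (\<lambda>x. f (h x)) = (\<Sum>j\<in>UNIV. tr (\<lambda>x. (h x $ j) *\<^sub>R f (axis j 1)))"
    by (simp only: tr_sum)
  also have "\<dots> = (\<Sum>j\<in>UNIV. h (f (axis j 1)) $ j)"
    using assms(2) by (intro sum.cong refl tr_rank_one)
      (auto intro!: linearI simp: linear_add linear_scale)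
  finally show ?thesis
    by (simp add: tr_def)
qed

lemma tr_ident: "tr (\<lambda>x :: real ^ 'n. x) = CARD('n)"
  by (simp add: tr_def)

text \<open>\<open>P_P\<close> is the polarised double product identity, and \<open>T\<close> is
  alternating by \<open>P_anti\<close> and \<open>P_skew\<close>. The abstract setting covers the
  model, the form at a point and its expression in a chart.\<close>

locale cross_form =
  fixes T :: "R7 \<Rightarrow> R7 \<Rightarrow> R7 \<Rightarrow> real" and g :: "R7 \<Rightarrow> R7 \<Rightarrow> real" and P :: "R7 \<Rightarrow> R7 \<Rightarrow> R7"
  assumes T_eq: "T u v w = g (P u v) w"
    and bilinear_g: "bilinear g"
    and g_sym: "g u v = g v u"
    and g_nondeg: "(\<And>w. g u w = 0) \<Longrightarrow> u = 0"
    and bilinear_P: "bilinear P"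
    and P_anti: "P v u = - P u v"
    and P_skew: "g (P u v) w = - g v (P u w)"
    and P_P: "P u (P v w) + P v (P u w) = g u w *\<^sub>R v + g v w *\<^sub>R u - (2 * g u v) *\<^sub>R w"
begin

lemmas g_linear = bilinear_ladd[OF bilinear_g] bilinear_radd[OF bilinear_g]
  bilinear_lmul[OF bilinear_g] bilinear_rmul[OF bilinear_g]
  bilinear_lneg[OF bilinear_g] bilinear_rneg[OF bilinear_g]
  bilinear_lsub[OF bilinear_g] bilinear_rsub[OF bilinear_g]
  bilinear_lzero[OF bilinear_g] bilinear_rzero[OF bilinear_g]
lemmas P_linear = bilinear_ladd[OF bilinear_P] bilinear_radd[OF bilinear_P]
  bilinear_lmul[OF bilinear_P] bilinear_rmul[OF bilinear_P]
  bilinear_lneg[OF bilinear_P] bilinear_rneg[OF bilinear_P]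
  bilinear_lsub[OF bilinear_P] bilinear_rsub[OF bilinear_P]
  bilinear_lzero[OF bilinear_P] bilinear_rzero[OF bilinear_P]

text \<open>In the trace of \<open>P_P\<close> the two products contribute equally by cyclicity, and
  the right side gives \<open>(1 + 1 - 2 * 7) * g u v\<close>.\<close>

lemma tr_P_P: "tr (\<lambda>w. P u (P v w)) = - 6 * g u v"
proof -
  have lin_P: "linear (P u)" for u
    by (intro linearI) (simp_all add: P_linear)
  have lin_g: "linear (g u)" for u
    by (intro linearI) (simp_all add: g_linear)
  have "tr (\<lambda>w. P u (P v w) + P v (P u w)) =
      tr (\<lambda>w. g u w *\<^sub>R v + g v w *\<^sub>R u - (2 * g u v) *\<^sub>R w)"
    by (simp only: P_P)
  also have "\<dots> = - 12 * g u v"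
    by (simp add: tr_add tr_diff tr_scaleR tr_ident tr_rank_one[OF lin_g] g_sym[of v u])
  finally show ?thesis
    by (simp add: tr_add tr_commute[OF lin_P lin_P, of v u])
qed

lemma g_eqI: "(\<And>w. g u w = g v w) \<Longrightarrow> u = v"
  using g_nondeg[of "u - v"] by (simp add: g_linear)

lemma P_self [simp]: "P u u = 0"
  using P_anti[of u u] by (simp add: eq_neg_iff_add_eq_0 flip: scaleR_2)

lemma g_P_left [simp]: "g u (P u v) = 0"
  using P_skew[of u u v] by (simp add: g_linear)

lemma g_P_right [simp]: "g u (P v u) = 0"
  by (subst P_anti) (simp add: g_linear)

lemma P_P_self: "P u (P u w) = g u w *\<^sub>R u - g u u *\<^sub>R w"
proof -
  have "2 * P u (P u w) $ i = 2 * (g u w *\<^sub>R u - g u u *\<^sub>R w) $ i" for i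
    using arg_cong[OF P_P[of u u w], of "\<lambda>x. x $ i"] by (simp add: algebra_simps)
  then have "P u (P u w) $ i = (g u w *\<^sub>R u - g u u *\<^sub>R w) $ i" for i
    by (metis mult_cancel_left zero_neq_numeral)
  then show ?thesis
    by (intro iffD2[OF vec_eq_iff] allI)
qed

text \<open>Nondegeneracy makes the map from \<open>u\<close> to \<open>g u\<close> injective, hence
  in finite dimension onto the dual space.\<close>

lemma riesz:
  assumes "linear c"
  obtains u where "\<And>w. g u w = c w"
proof -
  define f where "f u = (\<chi> i. g u (axis i 1))" for u
  have lin_g: "linear (g u)" for u
    by (rule bilinear_g[unfolded bilinear_def, THEN conjunct1, rule_format])
  have "linear f"
    by (intro linearI) (simp_all add: f_def vec_eq_iff g_linear)
  moreover have "u = 0" if "f u = 0" for u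
  proof (rule g_nondeg)
    show "g u w = 0" for w
      using that by (subst linear_axis_sum[OF lin_g]) (simp add: f_def vec_eq_iff)
  qed
  ultimately have "surj f"
    by (intro linear_injective_imp_surjective) (auto simp: linear_injective_0)
  then obtain u where u: "f u = (\<chi> i. c (axis i 1))"
    by (metis surjD)
  have "g u w = c w" for w
    using u by (subst linear_axis_sum[OF lin_g], subst linear_axis_sum[OF assms])
      (simp add: f_def vec_eq_iff)
  then show thesis by (rule that)
qed

end

section \<open>Cross products with a distinguished vector of square -1\<close>

locale unit_cross_form = cross_form +
  fixes \<xi> :: R7
  assumes unit: "g \<xi> \<xi> = -1"
begin

lemma P_P_unit: "P \<xi> (P \<xi> x) = x + g \<xi> x *\<^sub>R \<xi>"
  by (simp add: P_P_self unit)

lemma T_\<xi>_\<xi>: "T \<xi> x \<xi> = 0"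
  by (simp add: T_eq g_sym[of _ \<xi>])

text \<open>The kernel of the 2-form \<open>T \<xi>\<close> is the line through
  \<open>\<xi>\<close>, and the square of \<open>c\<close> detects this line because
  \<open>c \<xi>\<close> is nonzero.\<close>

lemma bordered_nondeg:
  assumes "linear c" "c \<xi> \<noteq> 0" and "\<And>w. T \<xi> x w + c x * c w = 0"
  shows "x = 0"
proof -
  have "c x = 0"
    using assms(3)[of \<xi>] assms(2) by (simp add: T_\<xi>_\<xi>)
  with assms(3) have "P \<xi> x = 0"
    by (intro g_nondeg) (simp add: T_eq)
  then have x: "x = - g \<xi> x *\<^sub>R \<xi>"
    using P_P_unit[of x] by (simp add: P_linear eq_neg_iff_add_eq_0)
  then have "c x = - g \<xi> x * c \<xi>"
    by (metis linear_scale[OF assms(1)] real_scaleR_def)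
  with \<open>c x = 0\<close> assms(2) x show ?thesis
    by simp
qed

text \<open>\<open>A\<close> is \<open>T v\<close> with an index raised by the bordered form; it
  differs from \<open>P \<xi> (P v x)\<close> by rank-one terms. Solved for
  \<open>g \<xi> v\<close>, the formula computes the metric dual of \<open>\<xi>\<close> from
  \<open>T\<close>, \<open>\<xi>\<close> and \<open>c\<close> alone.\<close>

lemma tr_bordered:
  assumes c: "linear c" "c \<xi> \<noteq> 0" and A: "\<And>x w. T \<xi> (A x) w + c (A x) * c w = T v x w"
  shows "tr A = 2 * c v / c \<xi> - 4 * g \<xi> v"
proof -
  obtain c' where c': "\<And>w. g c' w = c w"
    using riesz[OF c(1)] by blast
  \<comment> \<open>Testing the equation for \<open>A\<close> with \<open>w = \<xi>\<close> gives
    \<open>c (A x) = b x\<close>.\<close>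
  define b where "b x = T v x \<xi> / c \<xi>" for x
  \<comment> \<open>This is the part of \<open>A x\<close> orthogonal to \<open>\<xi>\<close>,
    obtained by applying \<open>P \<xi>\<close> twice to \<open>A x\<close>.\<close>
  define Y where "Y x = P \<xi> (P v x) - b x *\<^sub>R P \<xi> c'" for x
  have lin_b: "linear b"
    by (intro linearI) (simp_all add: b_def T_eq g_linear P_linear add_divide_distrib)
  have lin_Y: "linear Y"
    by (intro linearI) (simp_all add: Y_def linear_add[OF lin_b] linear_scale[OF lin_b]
        P_linear algebra_simps)
  have cA: "c (A x) = b x" for x
    using A[of x \<xi>] c(2) by (simp add: b_def T_eq g_sym[of _ \<xi>] field_simps)
  have "P \<xi> (A x) = P v x - b x *\<^sub>R c'" for x
    using A[of x] cA[of x] by (intro g_eqI) (simp add: T_eq g_linear c' algebra_simps)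
  then have AY: "A x + g \<xi> (A x) *\<^sub>R \<xi> = Y x" for x
    using P_P_unit[of "A x"] by (simp add: P_linear Y_def)
  \<comment> \<open>Applying \<open>c\<close> determines the remaining component of
    \<open>A x\<close> along \<open>\<xi>\<close>, since \<open>c (A x) = b x\<close> is
    known.\<close>
  then have "c (A x) + g \<xi> (A x) * c \<xi> = c (Y x)" for x
    by (metis AY linear_add[OF c(1)] linear_scale[OF c(1)] real_scaleR_def)
  then have "g \<xi> (A x) = c (Y x) / c \<xi> - b x / c \<xi>" for x
    using c(2) by (simp add: cA field_simps)
  then have "A x = Y x - (c (Y x) / c \<xi> - b x / c \<xi>) *\<^sub>R \<xi>" for x
    by (metis AY eq_diff_eq)
  then have "A = (\<lambda>x. Y x - (c (Y x) / c \<xi> - b x / c \<xi>) *\<^sub>R \<xi>)"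
    by auto
  moreover have lin_k: "linear (\<lambda>x. c (Y x) / c \<xi> - b x / c \<xi>)"
    by (intro linearI) (simp_all add: linear_add[OF lin_b] linear_scale[OF lin_b]
        linear_add[OF c(1)] linear_scale[OF c(1)] linear_add[OF lin_Y] linear_scale[OF lin_Y]
        add_divide_distrib algebra_simps)
  ultimately have "tr A = tr Y - (c (Y \<xi>) / c \<xi> - b \<xi> / c \<xi>)"
    by (simp only: tr_diff tr_rank_one[OF lin_k])
  moreover have "tr Y = - 6 * g \<xi> v - b (P \<xi> c')"
    unfolding Y_def by (simp add: tr_diff tr_P_P tr_rank_one[OF lin_b])
  moreover have "b \<xi> = 0"
    by (simp add: b_def T_eq g_sym[of _ \<xi>])
  moreover have "Y \<xi> = - v - g \<xi> v *\<^sub>R \<xi>"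
    using P_P_unit[of v] \<open>b \<xi> = 0\<close> by (simp add: Y_def P_anti[of v \<xi>] P_linear)
  then have "c (Y \<xi>) / c \<xi> = - c v / c \<xi> - g \<xi> v"
    using c(2) by (simp add: linear_diff[OF c(1)] linear_neg[OF c(1)] linear_scale[OF c(1)] diff_divide_distrib)
  moreover have "b (P \<xi> c') = - c v / c \<xi> - g \<xi> v"
  proof -
    have "g (P v (P \<xi> c')) \<xi> = - g (P \<xi> c') (P v \<xi>)"
      by (rule P_skew)
    also have "\<dots> = g (P \<xi> c') (P \<xi> v)"
      by (subst P_anti[of \<xi> v]) (simp add: g_linear)
    also have "\<dots> = - g c' (P \<xi> (P \<xi> v))"
      by (rule P_skew)
    finally show ?thesis
      using c(2) by (simp add: b_def T_eq P_P_unit g_linear c' diff_divide_distrib)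
  qed
  ultimately show ?thesis
    by simp
qed

text \<open>For \<open>c = g \<xi>\<close> the component along \<open>\<xi>\<close> is explicit,
  \<open>g \<xi> (A x) = - T v x \<xi>\<close>, so the operator itself is recovered and not only a
  trace.\<close>

lemma bordered_by_dual:
  assumes "\<And>x w. T \<xi> (A x) w + g \<xi> (A x) * g \<xi> w = T v x w"
  shows "A x - T v x \<xi> *\<^sub>R \<xi> = P \<xi> (P v x)"
proof -
  have h: "g \<xi> (A x) = - T v x \<xi>"
    using assms[of x \<xi>] by (simp add: T_\<xi>_\<xi> unit)
  have "P \<xi> (A x) = P v x + T v x \<xi> *\<^sub>R \<xi>"
    using assms[of x] by (intro g_eqI) (simp add: h g_linear T_eq[of \<xi>] T_eq[of v _ w for w] algebra_simps)
  then have "P \<xi> (P \<xi> (A x)) = P \<xi> (P v x)"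
    by (simp add: P_linear)
  then show ?thesis
    by (simp add: P_P_unit h)
qed

text \<open>Moving the left \<open>P \<xi>\<close> past \<open>P u\<close> by \<open>P_P\<close>
  brings the two factors \<open>P \<xi>\<close> together, where \<open>P_P_unit\<close> reduces them
  to the identity plus a rank-one term. What remains falls under \<open>tr_P_P\<close> and
  \<open>tr_rank_one\<close>.\<close>

lemma tr_P_P_P_P: "tr (\<lambda>x. P \<xi> (P u (P \<xi> (P v x)))) = 4 * g u v + 10 * g \<xi> u * g \<xi> v"
proof -
  have "P \<xi> (P u (P \<xi> (P v x))) = g u (P \<xi> (P v x)) *\<^sub>R \<xi> - (2 * g \<xi> u) *\<^sub>R P \<xi> (P v x)
      - P u (P v x) - g \<xi> (P v x) *\<^sub>R P u \<xi>" for x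
    using P_P[of \<xi> u "P \<xi> (P v x)"] by (simp add: P_P_unit P_linear algebra_simps)
  moreover have "linear (\<lambda>x. g u (P \<xi> (P v x)))" "linear (\<lambda>x. g \<xi> (P v x))"
    by (auto intro!: linearI simp: g_linear P_linear)
  ultimately have "tr (\<lambda>x. P \<xi> (P u (P \<xi> (P v x)))) =
      g u (P \<xi> (P v \<xi>)) + 12 * g \<xi> u * g \<xi> v + 6 * g u v - g \<xi> (P v (P u \<xi>))"
    by (simp add: tr_diff tr_scaleR tr_rank_one tr_P_P)
  moreover have "P v \<xi> = - P \<xi> v" "P u \<xi> = - P \<xi> u"
    by (rule P_anti)+
  moreover have "g \<xi> (P v (P \<xi> u)) = - g v u - g \<xi> v * g \<xi> u"
  proof -
    have "g \<xi> (P v (P \<xi> u)) = - g (P v \<xi>) (P \<xi> u)"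
      by (simp add: P_skew)
    also have "\<dots> = g (P \<xi> v) (P \<xi> u)"
      by (subst P_anti) (simp add: g_linear)
    also have "\<dots> = - g v (P \<xi> (P \<xi> u))"
      by (rule P_skew)
    finally show ?thesis
      by (simp add: P_P_unit g_linear g_sym[of v \<xi>])
  qed
  ultimately show ?thesis
    by (simp add: P_P_unit P_linear g_linear g_sym[of _ \<xi>] g_sym[of v u])
qed

end

text \<open>The vector product of the model is \<open>phi0\<close> with its last index raised by \<open>metric0\<close>.\<close>

definition cross0 :: "R7 \<Rightarrow> R7 \<Rightarrow> R7" where
  "cross0 u v = (\<chi> k. (if k \<in> {1, 2, 3, 4} then - 1 else 1) * phi0 u v (axis k 1))"

lemma cross0_nth:
  "cross0 u v $ 1 = u$2 * v$7 - u$7 * v$2 + (u$3 * v$5 - u$5 * v$3) - (u$4 * v$6 - u$6 * v$4)"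
  "cross0 u v $ 2 = u$7 * v$1 - u$1 * v$7 - (u$3 * v$6 - u$6 * v$3) - (u$4 * v$5 - u$5 * v$4)"
  "cross0 u v $ 3 = u$5 * v$1 - u$1 * v$5 + (u$2 * v$6 - u$6 * v$2) + (u$4 * v$7 - u$7 * v$4)"
  "cross0 u v $ 4 = u$1 * v$6 - u$6 * v$1 + (u$2 * v$5 - u$5 * v$2) - (u$3 * v$7 - u$7 * v$3)"
  "cross0 u v $ 5 = - (u$1 * v$3 - u$3 * v$1) + (u$2 * v$4 - u$4 * v$2) + (u$6 * v$7 - u$7 * v$6)"
  "cross0 u v $ 6 = u$1 * v$4 - u$4 * v$1 + (u$2 * v$3 - u$3 * v$2) - (u$5 * v$7 - u$7 * v$5)"
  "cross0 u v $ 7 = - (u$1 * v$2 - u$2 * v$1) - (u$3 * v$4 - u$4 * v$3) + (u$5 * v$6 - u$6 * v$5)"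
  by (simp_all add: cross0_def phi0_def wedge3_def axis_def)

lemma phi0_eq: "phi0 u v w = metric0 (cross0 u v) w"
  by (simp add: phi0_def wedge3_def metric0_def cross0_nth) (simp add: algebra_simps)

lemma cross0_cross0:
  "cross0 u (cross0 v w) + cross0 v (cross0 u w) =
    metric0 u w *\<^sub>R v + metric0 v w *\<^sub>R u - (2 * metric0 u v) *\<^sub>R w"
  unfolding vec_eq_iff forall_7 vector_add_component vector_minus_component vector_scaleR_component
    real_scaleR_def cross0_nth metric0_def
  by (intro conjI; simp add: algebra_simps)

lemma cross0_skew: "metric0 (cross0 u v) w = - metric0 v (cross0 u w)"
  by (simp add: metric0_def cross0_nth) (simp add: algebra_simps)

lemma cross0_anti: "cross0 v u = - cross0 u v"
  unfolding vec_eq_iff forall_7 by (simp add: cross0_nth)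

lemma bilinear_metric0: "bilinear metric0"
  unfolding bilinear_def by (auto intro!: linearI simp: metric0_def algebra_simps)

lemma linear_cross0: "linear (cross0 u)"
  by (rule linearI; unfold vec_eq_iff forall_7) (simp_all add: cross0_nth algebra_simps)

lemma bilinear_cross0: "bilinear cross0"
  unfolding bilinear_def
proof safe
  fix v
  have "(\<lambda>u. cross0 u v) = (\<lambda>u. - cross0 v u)"
    by (rule ext) (rule cross0_anti)
  then show "linear (\<lambda>u. cross0 u v)"
    by (simp only: linear_compose_neg[OF linear_cross0])
qed (rule linear_cross0)

lemma metric0_sym: "metric0 u v = metric0 v u"
  by (simp add: metric0_def)

lemma metric0_nondeg:
  assumes "\<And>w. metric0 u w = 0"
  shows "u = 0"
proof -
  have "\<forall>i. metric0 u (axis i 1) = 0"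
    by (simp add: assms)
  then show ?thesis
    unfolding vec_eq_iff forall_7 by (simp add: metric0_def axis_def)
qed

lemma cross_form_model: "cross_form phi0 metric0 cross0"
  by unfold_locales
    (fact phi0_eq bilinear_metric0 metric0_sym bilinear_cross0 cross0_anti cross0_skew
      cross0_cross0 | rule metric0_nondeg, assumption)+

text \<open>The axioms are invariant under linear isomorphisms. An adapted frame carries them from
  the model to a tangent space, and a coordinate change carries them on to the components in a
  chart.\<close>

lemma (in cross_form) pullback:
  assumes "linear L" "linear L'" "\<And>x. L (L' x) = x" "\<And>x. L' (L x) = x"
  shows "cross_form (\<lambda>u v w. T (L u) (L v) (L w)) (\<lambda>u v. g (L u) (L v)) (\<lambda>u v. L' (P (L u) (L v)))"
proof
  note L_linear = linear_add[OF assms(1)] linear_scale[OF assms(1)]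
    linear_add[OF assms(2)] linear_scale[OF assms(2)]
  show "T (L u) (L v) (L w) = g (L (L' (P (L u) (L v)))) (L w)" for u v w
    by (simp add: assms(3) T_eq)
  show "bilinear (\<lambda>u v. g (L u) (L v))" "bilinear (\<lambda>u v. L' (P (L u) (L v)))"
    unfolding bilinear_def by (auto intro!: linearI simp: g_linear P_linear L_linear)
  show "g (L u) (L v) = g (L v) (L u)" for u v
    by (rule g_sym)
  show "u = 0" if "\<And>w. g (L u) (L w) = 0" for u
  proof -
    have "L u = 0"
      using that[of "L' w" for w] by (intro g_nondeg) (simp add: assms(3))
    then show ?thesis
      by (metis assms(2,4) linear_0)
  qed
  show "L' (P (L v) (L u)) = - L' (P (L u) (L v))" for u v
    by (metis P_anti assms(2) linear_neg)
  show "g (L (L' (P (L u) (L v)))) (L w) = - g (L v) (L (L' (P (L u) (L w))))" for u v w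
    by (simp add: assms(3) P_skew)
  show "L' (P (L u) (L (L' (P (L v) (L w))))) + L' (P (L v) (L (L' (P (L u) (L w))))) =
      g (L u) (L w) *\<^sub>R v + g (L v) (L w) *\<^sub>R u - (2 * g (L u) (L v)) *\<^sub>R w"
    for u v w
    using arg_cong[OF P_P[of "L u" "L v" "L w"], of L']
    by (simp add: assms(3,4) L_linear linear_diff[OF assms(2)])
qed

lemma linear_inv_frame:
  assumes "g2star_frame T L"
  shows "linear (inv L)" "L (inv L x) = x" "inv L (L x) = x"
proof -
  have L: "linear L" "bij L"
    using assms by (auto simp: g2star_frame_def)
  show inv: "L (inv L x) = x" "inv L (L x) = x" for x
    using L(2) by (simp_all add: bij_is_surj surj_f_inv_f bij_is_inj)
  show "linear (inv L)"
    by (rule linearI) (metis inv linear_add[OF L(1)], metis inv linear_scale[OF L(1)])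
qed

lemma cross_form_frame:
  assumes "g2star_frame T L"
  shows "cross_form T (\<lambda>u v. metric0 (L u) (L v)) (\<lambda>u v. inv L (cross0 (L u) (L v)))"
proof -
  have "linear L" "T = (\<lambda>u v w. phi0 (L u) (L v) (L w))"
    using assms by (auto simp: g2star_frame_def fun_eq_iff)
  then show ?thesis
    using cross_form.pullback[OF cross_form_model _ linear_inv_frame[OF assms]] by simp
qed

section \<open>Smooth families of cross products\<close>

definition form_matrix :: "(real ^ 'n \<Rightarrow> real ^ 'n \<Rightarrow> real) \<Rightarrow> real ^ 'n ^ 'n" where
  "form_matrix B = (\<chi> i j. B (axis j 1) (axis i 1))"

text \<open>Writing the solution \<open>u\<close> of \<open>B u = r\<close> through an inverse
  matrix makes Cramer's rule available for its smoothness.\<close>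

definition raise :: "(real ^ 'n \<Rightarrow> real ^ 'n \<Rightarrow> real) \<Rightarrow> (real ^ 'n \<Rightarrow> real) \<Rightarrow> real ^ 'n" where
  "raise B r = matrix_inv (form_matrix B) *v (\<chi> i. r (axis i 1))"

text \<open>Columns of \<open>form_matrix\<close> belong to the first argument of \<open>B\<close>,
  so the matrix sends \<open>x\<close> to the Euclidean dual of \<open>B x\<close>.\<close>

lemma inner_form_matrix:
  fixes B :: "real ^ 'n \<Rightarrow> real ^ 'n \<Rightarrow> real"
  assumes "bilinear B"
  shows "(form_matrix B *v x) \<bullet> w = B x w"
proof -
  have lin: "linear (\<lambda>x. B x w)" "linear (B x)" for x w
    using assms by (simp_all add: bilinear_def)
  have "B x w = (\<Sum>i\<in>UNIV. w $ i * (\<Sum>j\<in>UNIV. x $ j * B (axis j 1) (axis i 1)))"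
    by (subst linear_axis_sum[OF lin(2)], subst linear_axis_sum[OF lin(1)]) simp
  then show ?thesis
    by (simp add: inner_vec_def form_matrix_def matrix_vector_mult_def mult.commute)
qed

lemma invertible_form_matrix:
  assumes "bilinear B" "\<And>x. (\<And>w. B x w = 0) \<Longrightarrow> x = 0"
  shows "invertible (form_matrix B)"
proof -
  have "x = 0" if "form_matrix B *v x = 0" for x
    using that inner_form_matrix[OF assms(1), of x] by (intro assms(2)) (metis inner_zero_left)
  then show ?thesis
    by (simp add: invertible_left_inverse matrix_left_invertible_ker)
qed

lemma raise:
  assumes "bilinear B" "\<And>x. (\<And>w. B x w = 0) \<Longrightarrow> x = 0" "linear r"
  shows "B (raise B r) w = r w"
proof -
  have "form_matrix B *v raise B r = (\<chi> i. r (axis i 1))"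
    using matrix_inv_right[OF invertible_form_matrix[OF assms(1,2)]]
    by (simp add: raise_def matrix_vector_mul_assoc)
  then have "B (raise B r) w = (\<chi> i. r (axis i 1)) \<bullet> w"
    by (metis assms(1) inner_form_matrix)
  also have "\<dots> = r w"
    by (subst (2) linear_axis_sum[OF assms(3)]) (simp add: inner_vec_def mult.commute)
  finally show ?thesis .
qed

lemma smooth_on_raise [smooth_intros]:
  fixes B :: "'a::euclidean_space \<Rightarrow> real ^ 'n \<Rightarrow> real ^ 'n \<Rightarrow> real"
  assumes "open S" "\<And>u v. smooth_on S (\<lambda>x. B x u v)" "\<And>u. smooth_on S (\<lambda>x. r x u)"
    and "\<And>x. x \<in> S \<Longrightarrow> bilinear (B x)"
    and "\<And>x u. x \<in> S \<Longrightarrow> (\<And>v. B x u v = 0) \<Longrightarrow> u = 0"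
  shows "smooth_on S (\<lambda>x. raise (B x) (r x))"
proof -
  have "smooth_on S (\<lambda>x. raise (B x) (r x) $ k)" for k
    unfolding raise_def
  proof (rule smooth_on_matrix_inv_mult[OF assms(1)])
    show "invertible (form_matrix (B x))" if "x \<in> S" for x
      using assms(4,5)[OF that] by (rule invertible_form_matrix)
  qed (simp_all add: form_matrix_def assms(2,3))
  then have "smooth_on S (\<lambda>x. \<chi> k. raise (B x) (r x) $ k)"
    by (rule smooth_on_vec[OF assms(1)])
  then show ?thesis
    by simp
qed

text \<open>Expanding \<open>X\<close> in the constant basis leaves smooth coefficients times values
  of the family on constant vectors.\<close>

lemma smooth_on_linear:
  fixes f :: "'a::euclidean_space \<Rightarrow> real ^ 'n \<Rightarrow> 'b::real_normed_vector"
  assumes "open S" "\<And>u. smooth_on S (\<lambda>x. f x u)" "\<And>x. x \<in> S \<Longrightarrow> linear (f x)" "smooth_on S X"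
  shows "smooth_on S (\<lambda>x. f x (X x))"
proof (subst smooth_on_cong[OF assms(1)])
  show "f x (X x) = (\<Sum>i\<in>UNIV. (X x $ i) *\<^sub>R f x (axis i 1))" if "x \<in> S" for x
    by (rule linear_axis_sum[OF assms(3)[OF that]])
  show "smooth_on S (\<lambda>x. \<Sum>i\<in>UNIV. (X x $ i) *\<^sub>R f x (axis i 1))"
    by (intro smooth_intros assms)
qed

lemma smooth_on_bilinear:
  fixes f :: "'a::euclidean_space \<Rightarrow> real ^ 'm \<Rightarrow> real ^ 'n \<Rightarrow> 'b::real_normed_vector"
  assumes "open S" "\<And>u v. smooth_on S (\<lambda>x. f x u v)" "\<And>x. x \<in> S \<Longrightarrow> bilinear (f x)"
    and "smooth_on S X" "smooth_on S Y"
  shows "smooth_on S (\<lambda>x. f x (X x) (Y x))"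
proof (rule smooth_on_linear[OF assms(1) _ _ assms(5)])
  show "smooth_on S (\<lambda>x. f x (X x) v)" for v
    by (rule smooth_on_linear[of S "\<lambda>x u. f x u v" X])
      (use assms in \<open>auto simp: bilinear_def\<close>)
qed (use assms(3) in \<open>auto simp: bilinear_def\<close>)

lemma smooth_on_tr [smooth_intros]:
  assumes "open S" "\<And>u. smooth_on S (\<lambda>x. f x u)"
  shows "smooth_on S (\<lambda>x. tr (f x))"
  unfolding tr_def by (intro smooth_intros assms)

section \<open>Recovering a smooth metric and product from a smooth 3-form\<close>

context cross_form
begin

lemma linear_g: "linear (g u)" and linear_P: "linear (P u)" and linear_T: "linear (T u v)"
  by (intro linearI; simp add: g_linear P_linear T_eq)+

lemma T_eq_right: "T u v w = g u (P v w)"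
  using P_skew[of v u w] by (simp add: T_eq P_anti[of u v] g_linear)

lemma T_anti: "T v u w = - T u v w" "T u w v = - T u v w"
  by (simp add: T_eq P_anti[of v u] g_linear) (simp add: T_eq_right P_anti[of w v] g_linear)

end

lemma (in unit_cross_form) bilinear_bordered:
  assumes "linear c"
  shows "bilinear (\<lambda>x w. T \<xi> x w + c x * c w)"
  unfolding bilinear_def
  by (auto intro!: linearI simp: g_linear P_linear T_eq linear_add[OF assms] linear_scale[OF assms] algebra_simps)

text \<open>Only \<open>T\<close> and \<open>\<xi>\<close> are assumed smooth. Smoothness of
  \<open>g\<close> and \<open>P\<close> has to be derived, because they will come from frames chosen
  independently at each point.\<close>

locale smooth_cross_form =
  fixes S :: "'a::euclidean_space set" and T g P \<xi>
  assumes open_S: "open S"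
    and unit_cross_form: "x \<in> S \<Longrightarrow> unit_cross_form (T x) (g x) (P x) (\<xi> x)"
    and smooth_T: "smooth_on S (\<lambda>x. T x u v w)"
    and smooth_\<xi>: "smooth_on S \<xi>"
begin

lemma cross_form: "x \<in> S \<Longrightarrow> cross_form (T x) (g x) (P x)"
  using unit_cross_form unit_cross_form.axioms by blast

lemma smooth_T_\<xi>: "smooth_on S (\<lambda>x. T x (\<xi> x) v w)"
proof (rule smooth_on_linear[OF open_S _ _ smooth_\<xi>])
  show "linear (\<lambda>u. T x u v w)" if "x \<in> S" for x
  proof -
    interpret cross_form "T x" "g x" "P x"
      using that by (rule cross_form)
    show ?thesis
      by (intro linearI) (simp_all add: g_linear P_linear T_eq)
  qed
qed (rule smooth_T)

text \<open>Here \<open>T\<close> is bordered with the Euclidean dual of \<open>\<xi>\<close>, since the metric dual is not yet known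
  to be smooth.\<close>

lemma smooth_g_\<xi>: "smooth_on S (\<lambda>x. g x (\<xi> x) v)"
proof -
  define B where "B x y w = T x (\<xi> x) y w + (\<xi> x \<bullet> y) * (\<xi> x \<bullet> w)" for x y w
  define A where "A x y = raise (B x) (T x v y)" for x y
  \<comment> \<open>As \<open>g\<close> takes the value -1 on \<open>\<xi>\<close>, the vector
    \<open>\<xi> x\<close> is nonzero, so its Euclidean dual is an admissible border.\<close>
  have nz: "\<xi> x \<bullet> \<xi> x \<noteq> 0" if "x \<in> S" for x
  proof -
    interpret unit_cross_form "T x" "g x" "P x" "\<xi> x"
      using that by (rule unit_cross_form)
    show ?thesis
      using unit by (auto simp: g_linear)
  qed
  have B: "bilinear (B x)" "(\<And>w. B x y w = 0) \<Longrightarrow> y = 0" if "x \<in> S" for x y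
  proof -
    interpret unit_cross_form "T x" "g x" "P x" "\<xi> x"
      using that by (rule unit_cross_form)
    have lin: "linear ((\<bullet>) (\<xi> x))"
      by (intro linearI) (simp_all add: inner_add_right)
    show "bilinear (B x)"
      using bilinear_bordered[OF lin] by (simp add: B_def[abs_def])
    show "(\<And>w. B x y w = 0) \<Longrightarrow> y = 0"
      using bordered_nondeg[OF lin nz[OF that], of y] by (simp add: B_def)
  qed
  \<comment> \<open>This is \<open>tr_bordered\<close>, solved for the metric term.\<close>
  have "g x (\<xi> x) v = ((2 * (\<xi> x \<bullet> v)) / (\<xi> x \<bullet> \<xi> x) - tr (A x)) / 4" if "x \<in> S" for x
  proof -
    interpret unit_cross_form "T x" "g x" "P x" "\<xi> x"
      using that by (rule unit_cross_form)
    have lin: "linear ((\<bullet>) (\<xi> x))"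
      by (intro linearI) (simp_all add: inner_add_right)
    have "B x (A x y) w = T x v y w" for y w
      unfolding A_def by (rule raise[OF B[OF that] linear_T])
    then have "tr (A x) = 2 * (\<xi> x \<bullet> v) / (\<xi> x \<bullet> \<xi> x) - 4 * g x (\<xi> x) v"
      by (intro tr_bordered[OF lin nz[OF that]]) (simp add: B_def)
    then show ?thesis
      by simp
  qed
  moreover have inner: "smooth_on S (\<lambda>x. \<xi> x \<bullet> y x)" if "smooth_on S y" for y
    by (rule bounded_bilinear.smooth_on[OF bounded_bilinear_inner open_S smooth_\<xi> that])
  have "smooth_on S (\<lambda>x. A x y)" for y
    unfolding A_def
    by (rule smooth_on_raise[OF open_S _ _ B])
      (auto simp: B_def intro!: smooth_intros inner open_S smooth_T smooth_T_\<xi>)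
  then have "smooth_on S (\<lambda>x. ((2 * (\<xi> x \<bullet> v)) / (\<xi> x \<bullet> \<xi> x) - tr (A x)) / 4)"
    by (intro smooth_intros inner open_S nz smooth_\<xi>) simp_all
  ultimately show ?thesis
    by (subst smooth_on_cong[OF open_S])
qed

text \<open>The metric dual of \<open>\<xi>\<close> is smooth by now and can serve as the border, so
  \<open>bordered_by_dual\<close> expresses the operator through smooth data.\<close>

lemma smooth_P_\<xi>_P: "smooth_on S (\<lambda>x. P x (\<xi> x) (P x v y))"
proof -
  define B where "B x y w = T x (\<xi> x) y w + g x (\<xi> x) y * g x (\<xi> x) w" for x y w
  define A where "A x y = raise (B x) (T x v y)" for x y
  have B: "bilinear (B x)" "(\<And>w. B x y w = 0) \<Longrightarrow> y = 0" if "x \<in> S" for x y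
  proof -
    interpret unit_cross_form "T x" "g x" "P x" "\<xi> x"
      using that by (rule unit_cross_form)
    show "bilinear (B x)"
      using bilinear_bordered[OF linear_g] by (simp add: B_def[abs_def])
    show "(\<And>w. B x y w = 0) \<Longrightarrow> y = 0"
      using bordered_nondeg[OF linear_g, of "\<xi> x" y] by (simp add: B_def unit)
  qed
  have eq: "P x (\<xi> x) (P x v y) = A x y - T x v y (\<xi> x) *\<^sub>R \<xi> x" if "x \<in> S" for x
  proof -
    interpret unit_cross_form "T x" "g x" "P x" "\<xi> x"
      using that by (rule unit_cross_form)
    have "B x (A x y) w = T x v y w" for y w
      unfolding A_def by (rule raise[OF B[OF that] linear_T])
    then show ?thesis
      by (intro bordered_by_dual[symmetric]) (simp add: B_def)
  qed
  have "smooth_on S (\<lambda>x. A x y)"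
    unfolding A_def
    by (rule smooth_on_raise[OF open_S _ _ B])
      (auto simp: B_def intro!: smooth_intros open_S smooth_T smooth_T_\<xi> smooth_g_\<xi>)
  moreover have "smooth_on S (\<lambda>x. T x v y (\<xi> x))"
    by (rule smooth_on_linear[OF open_S smooth_T _ smooth_\<xi>])
      (rule cross_form.linear_T[OF cross_form])
  ultimately have "smooth_on S (\<lambda>x. A x y - T x v y (\<xi> x) *\<^sub>R \<xi> x)"
    by (intro smooth_intros open_S smooth_\<xi>)
  then show ?thesis
    by (subst smooth_on_cong[OF open_S]) (rule eq)
qed

text \<open>The identity \<open>tr_P_P_P_P\<close> is solved for \<open>g u v\<close>; its other
  terms are smooth by the two preceding lemmas.\<close>

lemma smooth_g: "smooth_on S (\<lambda>x. g x u v)"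
proof -
  have "smooth_on S (\<lambda>x. P x (\<xi> x) (P x u (P x (\<xi> x) (P x v y))))" for y
  proof (rule smooth_on_linear[OF open_S smooth_P_\<xi>_P _ smooth_P_\<xi>_P])
    show "linear (\<lambda>y. P x (\<xi> x) (P x u y))" if "x \<in> S" for x
      using linear_compose[OF cross_form.linear_P cross_form.linear_P, OF cross_form cross_form, OF that that]
      by (simp add: comp_def)
  qed
  then have "smooth_on S (\<lambda>x. (tr (\<lambda>y. P x (\<xi> x) (P x u (P x (\<xi> x) (P x v y))))
      - 10 * g x (\<xi> x) u * g x (\<xi> x) v) / 4)"
    by (intro smooth_intros open_S smooth_g_\<xi>) simp_all
  then show ?thesis
    by (subst smooth_on_cong[OF open_S])
      (auto simp: unit_cross_form.tr_P_P_P_P[OF unit_cross_form])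
qed

text \<open>Once \<open>g\<close> is smooth, \<open>P u v\<close> is smooth as the form
  \<open>T u v\<close> with its index raised by \<open>g\<close>.\<close>

lemma smooth_P: "smooth_on S (\<lambda>x. P x u v)"
proof -
  have "P x u v = raise (g x) (T x u v)" if "x \<in> S" for x
  proof -
    interpret cross_form "T x" "g x" "P x"
      using that by (rule cross_form)
    show ?thesis
      by (rule g_eqI) (simp add: raise[OF bilinear_g g_nondeg linear_T] T_eq)
  qed
  moreover have "smooth_on S (\<lambda>x. raise (g x) (T x u v))"
    by (rule smooth_on_raise[OF open_S smooth_g smooth_T cross_form.bilinear_g cross_form.g_nondeg])
      (rule cross_form | assumption)+
  ultimately show ?thesis
    by (subst smooth_on_cong[OF open_S])
qed

lemma smooth_g_fields: "smooth_on S X \<Longrightarrow> smooth_on S Y \<Longrightarrow> smooth_on S (\<lambda>x. g x (X x) (Y x))"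
  by (rule smooth_on_bilinear[OF open_S smooth_g cross_form.bilinear_g[OF cross_form]])

lemma smooth_P_fields: "smooth_on S X \<Longrightarrow> smooth_on S Y \<Longrightarrow> smooth_on S (\<lambda>x. P x (X x) (Y x))"
  by (rule smooth_on_bilinear[OF open_S smooth_P cross_form.bilinear_P[OF cross_form]])

end

section \<open>Smooth manifolds\<close>

locale smooth_manifold_7 =
  fixes A :: "'m::topological_space chart set"
  assumes smooth_atlas: "smooth_atlas A"
begin

lemma chart_at_in: "chart_at A p \<in> A" and in_chart_at: "p \<in> chart_dom (chart_at A p)"
proof -
  have "p \<in> (\<Union>c\<in>A. chart_dom c)"
    using smooth_atlas by (simp add: smooth_atlas_def)
  then have "\<exists>c. c \<in> A \<and> p \<in> chart_dom c"
    by blast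
  then have "chart_at A p \<in> A \<and> p \<in> chart_dom (chart_at A p)"
    unfolding chart_at_def by (rule someI_ex)
  then show "chart_at A p \<in> A" "p \<in> chart_dom (chart_at A p)"
    by simp_all
qed

lemma chart_homeomorphism:
  "c \<in> A \<Longrightarrow> homeomorphism (chart_dom c) (chart_img c) (chart_map c) (chart_inv c)"
  using smooth_atlas unfolding smooth_atlas_def by blast

lemma open_chart_img: "c \<in> A \<Longrightarrow> open (chart_img c)"
  using smooth_atlas unfolding smooth_atlas_def by blast

lemma chart_inv_map: "c \<in> A \<Longrightarrow> p \<in> chart_dom c \<Longrightarrow> chart_inv c (chart_map c p) = p"
  using chart_homeomorphism by (auto simp: homeomorphism_def)

lemma chart_inv_in: "c \<in> A \<Longrightarrow> x \<in> chart_img c \<Longrightarrow> chart_inv c x \<in> chart_dom c"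
  using homeomorphism_image2[OF chart_homeomorphism] by blast

lemma chart_map_in: "p \<in> chart_dom c \<Longrightarrow> chart_map c p \<in> chart_img c"
  by (simp add: chart_img_def)

section \<open>Coordinate changes\<close>

lemma open_overlap:
  assumes "c \<in> A" "d \<in> A"
  shows "open (chart_map c ` (chart_dom c \<inter> chart_dom d))"
proof -
  have "open (chart_dom d)"
    using smooth_atlas assms unfolding smooth_atlas_def by blast
  then have "openin (top_of_set (chart_dom c)) (chart_dom c \<inter> chart_dom d)"
    by blast
  then have "openin (top_of_set (chart_img c)) (chart_map c ` (chart_dom c \<inter> chart_dom d))"
    by (rule homeomorphism_imp_open_map[OF chart_homeomorphism[OF assms(1)]])
  then show ?thesis
    using open_chart_img[OF assms(1)] by (rule openin_open_trans)
qed

text \<open>Smoothness on the overlap provides a derivative; otherwise \<open>chart_change\<close>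
  would be an unspecified value of \<open>frechet_derivative\<close>.\<close>

lemma has_derivative_chart_change:
  assumes "c \<in> A" "d \<in> A" "p \<in> chart_dom c" "p \<in> chart_dom d"
  shows "(chart_map d \<circ> chart_inv c has_derivative chart_change c d p) (at (chart_map c p))"
proof -
  have "smooth_on (chart_map c ` (chart_dom c \<inter> chart_dom d)) (chart_map d \<circ> chart_inv c)"
    using smooth_atlas assms unfolding smooth_atlas_def by blast
  then have "(chart_map d \<circ> chart_inv c) differentiable (at (chart_map c p))"
    using assms by (intro smooth_on_imp_differentiable) auto
  then show ?thesis
    by (simp add: chart_change_def frechet_derivative_works)
qed

lemma linear_chart_change:
  assumes "c \<in> A" "d \<in> A" "p \<in> chart_dom c" "p \<in> chart_dom d"
  shows "linear (chart_change c d p)"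
  using has_derivative_chart_change[OF assms] by (rule has_derivative_linear)

text \<open>By the chain rule: the composite of the two coordinate changes is the identity near the
  point.\<close>

lemma chart_change_inverse:
  assumes "c \<in> A" "d \<in> A" "p \<in> chart_dom c" "p \<in> chart_dom d"
  shows "chart_change d c p (chart_change c d p v) = v"
proof -
  have "(chart_map c \<circ> chart_inv d has_derivative chart_change d c p)
      (at ((chart_map d \<circ> chart_inv c) (chart_map c p)))"
    using has_derivative_chart_change[OF assms(2,1,4,3)] by (simp add: chart_inv_map assms)
  from diff_chain_at[OF has_derivative_chart_change[OF assms] this]
  have "((chart_map c \<circ> chart_inv d) \<circ> (chart_map d \<circ> chart_inv c)
      has_derivative chart_change d c p \<circ> chart_change c d p) (at (chart_map c p))" .
  then have "((\<lambda>x. x) has_derivative chart_change d c p \<circ> chart_change c d p) (at (chart_map c p))"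
    by (rule has_derivative_transform_within_open[OF _ open_overlap[OF assms(1,2)]])
      (use assms in \<open>auto simp: chart_inv_map\<close>)
  from has_derivative_unique[OF this has_derivative_ident]
  show ?thesis
    by (simp add: fun_eq_iff)
qed

text \<open>The stored components at a point refer to \<open>chart_at\<close>, which may jump. These
  conversions need not be continuous in \<open>x\<close>, so only fields already expressed in
  \<open>c\<close> are tested for smoothness.\<close>

abbreviation to_chart :: "'m chart \<Rightarrow> R7 \<Rightarrow> R7 \<Rightarrow> R7" where
  "to_chart c x \<equiv> chart_change (chart_at A (chart_inv c x)) c (chart_inv c x)"

abbreviation from_chart :: "'m chart \<Rightarrow> R7 \<Rightarrow> R7 \<Rightarrow> R7" where
  "from_chart c x \<equiv> chart_change c (chart_at A (chart_inv c x)) (chart_inv c x)"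

lemma
  assumes "c \<in> A" "x \<in> chart_img c"
  shows linear_to_chart: "linear (to_chart c x)"
    and linear_from_chart: "linear (from_chart c x)"
    and to_from_chart: "to_chart c x (from_chart c x v) = v"
    and from_to_chart: "from_chart c x (to_chart c x v) = v"
  by (rule linear_chart_change chart_change_inverse;
      use assms chart_at_in in_chart_at chart_inv_in in blast)+

section \<open>Smooth fields and functions in charts\<close>

lemma smooth_field_iff:
  "smooth_field A X \<longleftrightarrow>
    (\<forall>c\<in>A. smooth_on (chart_img c) (\<lambda>x. to_chart c x (X (chart_inv c x))))"
  by (simp add: smooth_field_def comp_def)

lemma smooth_function_iff:
  "smooth_function A f \<longleftrightarrow> (\<forall>c\<in>A. smooth_on (chart_img c) (\<lambda>x. f (chart_inv c x)))"
  by (simp add: smooth_function_def comp_def)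

lemma smooth_field_scaleR:
  assumes "smooth_function A f" "smooth_field A X"
  shows "smooth_field A (\<lambda>q. f q *\<^sub>R X q)"
  unfolding smooth_field_iff
proof
  fix c assume c: "c \<in> A"
  have "smooth_on (chart_img c)
      (\<lambda>x. f (chart_inv c x) *\<^sub>R to_chart c x (X (chart_inv c x)))"
    using assms c by (intro smooth_on_scaleR open_chart_img) (auto simp: smooth_field_iff smooth_function_iff)
  then show "smooth_on (chart_img c) (\<lambda>x. to_chart c x (f (chart_inv c x) *\<^sub>R X (chart_inv c x)))"
    by (subst smooth_on_cong[OF open_chart_img[OF c]]) (auto simp: linear_scale[OF linear_to_chart[OF c]])
qed

lemma field_deriv_minus:
  assumes "smooth_function A f"
  shows "field_deriv A X (\<lambda>q. - f q) p = - field_deriv A X f p"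
proof -
  define F where "F = f \<circ> chart_inv (chart_at A p)"
  define x where "x = chart_map (chart_at A p) p"
  have "F differentiable (at x)"
    unfolding F_def x_def using assms chart_at_in
    by (auto intro!: smooth_on_imp_differentiable chart_map_in in_chart_at simp: smooth_function_def)
  then have "(F has_derivative frechet_derivative F (at x)) (at x)"
    by (simp add: frechet_derivative_works)
  from frechet_derivative_at[OF has_derivative_minus[OF this], symmetric]
  have "frechet_derivative (\<lambda>y. - F y) (at x) (X p) = - frechet_derivative F (at x) (X p)"
    by simp
  then show ?thesis
    by (simp add: field_deriv_def F_def x_def comp_def)
qed

lemma field_deriv_const: "field_deriv A X (\<lambda>q. a) p = 0"
  by (simp add: field_deriv_def comp_def)

end

section \<open>Unit Killing fields on manifolds with a \<open>G\<^sub>2\<^sup>*\<close> structure\<close>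

text \<open>Metric and product are read in the one frame chosen inside \<open>g43\<close>. The
  definite description in \<open>cross_product\<close> resolves because the metric is
  nondegenerate.\<close>

lemma cross_form_g2star:
  assumes "\<exists>L. g2star_frame (\<phi> p) L"
  shows "cross_form (\<phi> p) (g43 \<phi> p) (cross_product \<phi> p)"
proof -
  define L where "L = (SOME L. g2star_frame (\<phi> p) L)"
  have "g2star_frame (\<phi> p) L"
    unfolding L_def using assms by (rule someI_ex)
  moreover have g: "g43 \<phi> p = (\<lambda>u v. metric0 (L u) (L v))"
    by (simp add: fun_eq_iff g43_def L_def Let_def)
  ultimately interpret cross_form "\<phi> p" "g43 \<phi> p" "\<lambda>u v. inv L (cross0 (L u) (L v))"
    using cross_form_frame by simp
  have "cross_product \<phi> p u v = inv L (cross0 (L u) (L v))" for u v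
    unfolding cross_product_def by (rule the_equality) (auto simp: T_eq intro: g_eqI)
  then have "cross_product \<phi> p = (\<lambda>u v. inv L (cross0 (L u) (L v)))"
    by (simp add: fun_eq_iff)
  then show ?thesis
    by (simp add: cross_form_axioms)
qed

locale g2star_unit_field = smooth_manifold_7 A for A :: "'m::topological_space chart set" +
  fixes \<phi> :: "'m \<Rightarrow> R7 \<Rightarrow> R7 \<Rightarrow> R7 \<Rightarrow> real" and \<xi> :: "'m \<Rightarrow> R7"
  assumes g2star: "g2star_structure A \<phi>"
    and smooth_\<xi>: "smooth_field A \<xi>"
    and unit_\<xi>: "g43 \<phi> p (\<xi> p) (\<xi> p) = -1"
begin

abbreviation "g \<equiv> g43 \<phi>"

abbreviation "P \<equiv> cross_product \<phi>"

lemma cross_form: "cross_form (\<phi> p) (g p) (P p)"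
  using g2star by (intro cross_form_g2star) (simp add: g2star_structure_def)

lemma unit_cross_form: "unit_cross_form (\<phi> p) (g p) (P p) (\<xi> p)"
  using cross_form unit_\<xi> by (simp add: unit_cross_form_def unit_cross_form_axioms_def)

text \<open>In the components of \<open>c\<close> the structure at each point is a pullback along
  \<open>from_chart\<close>, with inverse \<open>to_chart\<close>. This makes the smoothness results
  for families available on the manifold.\<close>

lemma smooth_cross_form_chart:
  assumes c: "c \<in> A"
  shows "smooth_cross_form (chart_img c)
    (\<lambda>x u v w. \<phi> (chart_inv c x) (from_chart c x u) (from_chart c x v) (from_chart c x w))
    (\<lambda>x u v. g (chart_inv c x) (from_chart c x u) (from_chart c x v))
    (\<lambda>x u v. to_chart c x (P (chart_inv c x) (from_chart c x u) (from_chart c x v)))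
    (\<lambda>x. to_chart c x (\<xi> (chart_inv c x)))"
proof (rule smooth_cross_form.intro)
  show "open (chart_img c)"
    by (rule open_chart_img[OF c])
  show "smooth_on (chart_img c)
      (\<lambda>x. \<phi> (chart_inv c x) (from_chart c x u) (from_chart c x v) (from_chart c x w))" for u v w
    using g2star c by (auto simp: g2star_structure_def smooth_3form_def comp_def)
  show "smooth_on (chart_img c) (\<lambda>x. to_chart c x (\<xi> (chart_inv c x)))"
    using smooth_\<xi> c by (simp add: smooth_field_iff)
  show "unit_cross_form
      (\<lambda>u v w. \<phi> (chart_inv c x) (from_chart c x u) (from_chart c x v) (from_chart c x w))
      (\<lambda>u v. g (chart_inv c x) (from_chart c x u) (from_chart c x v))
      (\<lambda>u v. to_chart c x (P (chart_inv c x) (from_chart c x u) (from_chart c x v)))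
      (to_chart c x (\<xi> (chart_inv c x)))"
    if "x \<in> chart_img c" for x
    unfolding unit_cross_form_def unit_cross_form_axioms_def
    using cross_form.pullback[OF cross_form linear_from_chart linear_to_chart from_to_chart to_from_chart,
        OF c that c that c that c that] unit_\<xi>
    by (simp add: from_to_chart[OF c that])
qed

lemma smooth_function_g:
  assumes "smooth_field A X" "smooth_field A Y"
  shows "smooth_function A (\<lambda>q. g q (X q) (Y q))"
  unfolding smooth_function_iff
proof
  fix c assume c: "c \<in> A"
  show "smooth_on (chart_img c) (\<lambda>x. g (chart_inv c x) (X (chart_inv c x)) (Y (chart_inv c x)))"
    using smooth_cross_form.smooth_g_fields[OF smooth_cross_form_chart[OF c],
        OF assms[unfolded smooth_field_iff, rule_format, OF c]]
    by (subst smooth_on_cong[OF open_chart_img[OF c]]) (simp_all add: from_to_chart[OF c])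
qed

lemma smooth_field_P:
  assumes "smooth_field A X" "smooth_field A Y"
  shows "smooth_field A (\<lambda>q. P q (X q) (Y q))"
  unfolding smooth_field_iff
proof
  fix c assume c: "c \<in> A"
  show "smooth_on (chart_img c)
      (\<lambda>x. to_chart c x (P (chart_inv c x) (X (chart_inv c x)) (Y (chart_inv c x))))"
    using smooth_cross_form.smooth_P_fields[OF smooth_cross_form_chart[OF c],
        OF assms[unfolded smooth_field_iff, rule_format, OF c]]
    by (subst smooth_on_cong[OF open_chart_img[OF c]]) (simp_all add: from_to_chart[OF c])
qed

lemma smooth_function_\<phi>:
  assumes "smooth_field A X" "smooth_field A Y" "smooth_field A Z"
  shows "smooth_function A (\<lambda>q. \<phi> q (X q) (Y q) (Z q))"
  using smooth_function_g[OF smooth_field_P[OF assms(1,2)] assms(3)]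
  by (simp add: cross_form.T_eq[OF cross_form])

end

section \<open>Covariant derivatives along a unit Killing field\<close>

locale levi_civita_killing = g2star_unit_field A \<phi> \<xi>
  for A :: "'m::topological_space chart set" and \<phi> \<xi> +
  fixes nabla :: "('m \<Rightarrow> R7) \<Rightarrow> ('m \<Rightarrow> R7) \<Rightarrow> 'm \<Rightarrow> R7"
  assumes levi_civita: "levi_civita_connection A (pc_metric \<phi>) nabla"
    and killing: "killing_field A (pc_metric \<phi>) nabla \<xi>"
begin

lemma nabla_add:
  "smooth_field A X \<Longrightarrow> smooth_field A Y \<Longrightarrow> smooth_field A Z \<Longrightarrow>
    nabla X (\<lambda>q. Y q + Z q) p = nabla X Y p + nabla X Z p"
  using levi_civita by (simp add: levi_civita_connection_def affine_connection_def)

lemma nabla_scaleR: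
  "smooth_function A f \<Longrightarrow> smooth_field A X \<Longrightarrow> smooth_field A Y \<Longrightarrow>
    nabla X (\<lambda>q. f q *\<^sub>R Y q) p = field_deriv A X f p *\<^sub>R Y p + f p *\<^sub>R nabla X Y p"
  using levi_civita by (simp add: levi_civita_connection_def affine_connection_def)

text \<open>The Killing equation turns the left side into
  \<open>- g(\<nabla>_V \<xi>, \<xi>)\<close>, minus half the derivative of the constant
  \<open>g(\<xi>, \<xi>)\<close>.\<close>

lemma g_nabla_\<xi>_\<xi>:
  assumes "smooth_field A V"
  shows "g p (nabla \<xi> \<xi> p) (V p) = 0"
proof -
  interpret cross_form "\<phi> p" "g p" "P p"
    by (rule cross_form)
  have "pc_metric \<phi> p (nabla \<xi> \<xi> p) (V p) = - pc_metric \<phi> p (nabla V \<xi> p) (\<xi> p)"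
    using killing assms smooth_\<xi> unfolding killing_field_def by blast
  moreover have "field_deriv A V (\<lambda>q. pc_metric \<phi> q (\<xi> q) (\<xi> q)) p =
      pc_metric \<phi> p (nabla V \<xi> p) (\<xi> p) + pc_metric \<phi> p (\<xi> p) (nabla V \<xi> p)"
    using levi_civita assms smooth_\<xi> unfolding levi_civita_connection_def by blast
  ultimately show ?thesis
    by (simp add: pc_metric_def unit_\<xi> field_deriv_const g_sym[of "\<xi> p" "nabla V \<xi> p"])
qed

text \<open>The preceding lemma tests only against smooth fields. Since \<open>P(Y, Z)\<close> is
  such a field, no tangent vector has to be extended.\<close>

lemma \<phi>_nabla_\<xi>_\<xi>:
  assumes "smooth_field A Y" "smooth_field A Z"
  shows "\<phi> p (nabla \<xi> \<xi> p) (Y p) (Z p) = 0"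
proof -
  interpret cross_form "\<phi> p" "g p" "P p"
    by (rule cross_form)
  have "\<phi> p (nabla \<xi> \<xi> p) (Y p) (Z p) = g p (nabla \<xi> \<xi> p) (P p (Y p) (Z p))"
    by (rule T_eq_right)
  also have "\<dots> = 0"
    by (rule g_nabla_\<xi>_\<xi>[OF smooth_field_P[OF assms]])
  finally show ?thesis .
qed

text \<open>The sign is due to \<open>\<eta>(Y) = - g(\<xi>, Y)\<close>.\<close>

abbreviation horizontal :: "('m \<Rightarrow> R7) \<Rightarrow> 'm \<Rightarrow> R7" where
  "horizontal Y \<equiv> \<lambda>q. Y q + g q (\<xi> q) (Y q) *\<^sub>R \<xi> q"

lemma pc_endo_pc_endo: "pc_endo \<phi> \<xi> q (pc_endo \<phi> \<xi> q y) = y + g q (\<xi> q) y *\<^sub>R \<xi> q"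
  by (simp add: pc_endo_def unit_cross_form.P_P_unit[OF unit_cross_form])

lemma fundamental_2form_eq: "fundamental_2form \<phi> \<xi> q u v = - \<phi> q (\<xi> q) u v"
  by (simp add: fundamental_2form_def pc_metric_def pc_endo_def cross_form.T_eq[OF cross_form])

lemma \<phi>_\<xi>_multiple:
  "\<phi> q (\<xi> q) (y + a *\<^sub>R \<xi> q) z = \<phi> q (\<xi> q) y z"
  "\<phi> q (\<xi> q) z (y + a *\<^sub>R \<xi> q) = \<phi> q (\<xi> q) z y"
proof -
  interpret unit_cross_form "\<phi> q" "g q" "P q" "\<xi> q"
    by (rule unit_cross_form)
  show "\<phi> q (\<xi> q) (y + a *\<^sub>R \<xi> q) z = \<phi> q (\<xi> q) y z"
    by (simp add: T_eq g_linear P_linear)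
  show "\<phi> q (\<xi> q) z (y + a *\<^sub>R \<xi> q) = \<phi> q (\<xi> q) z y"
    using T_\<xi>_\<xi> by (simp add: linear_add[OF linear_T] linear_scale[OF linear_T])
qed

text \<open>By the Leibniz rule \<open>a\<close> is the derivative of \<open>g(\<xi>, Y)\<close>
  along \<open>\<xi>\<close>, and \<open>b\<close> is \<open>g(\<xi>, Y)\<close> at
  \<open>p\<close>. The rule applies because this function is smooth.\<close>

lemma nabla_\<xi>_horizontal:
  assumes "smooth_field A Y"
  obtains a b where "nabla \<xi> (horizontal Y) p = (nabla \<xi> Y p + a *\<^sub>R \<xi> p) + b *\<^sub>R nabla \<xi> \<xi> p"
proof -
  have g: "smooth_function A (\<lambda>q. g q (\<xi> q) (Y q))"
    by (intro smooth_function_g smooth_\<xi> assms)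
  show thesis
    by (rule that)
      (simp add: nabla_add[OF smooth_\<xi> assms smooth_field_scaleR[OF g smooth_\<xi>]]
        nabla_scaleR[OF g smooth_\<xi> smooth_\<xi>] add.assoc)
qed

lemma F11_eq:
  assumes "smooth_field A Y" "smooth_field A Z"
  shows "F11 A nabla \<phi> \<xi> X Y Z p = - pc_eta \<phi> \<xi> p (X p) * cov_deriv3 A nabla \<phi> \<xi> \<xi> Y Z p"
proof -
  interpret unit_cross_form "\<phi> p" "g p" "P p" "\<xi> p"
    by (rule unit_cross_form)
  let ?W = "nabla \<xi> \<xi>"
  have skew: "\<phi> p u v w = - \<phi> p v u w" "\<phi> p u v w = - \<phi> p u w v" for u v w
    by (rule T_anti)+
  \<comment> \<open>Alternation moves \<open>?W\<close> to the first slot, where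
    \<open>\<phi>_nabla_\<xi>_\<xi>\<close> applies with \<open>\<xi>\<close> as one of the two
    fields.\<close>
  have W: "\<phi> p (\<xi> p) (?W p) (V p) = 0" "\<phi> p (\<xi> p) (V p) (?W p) = 0" if "smooth_field A V" for V
    using \<phi>_nabla_\<xi>_\<xi>[OF smooth_\<xi> that] skew(1)[of "\<xi> p" "?W p"] skew(2)[of "\<xi> p" "V p" "?W p"]
    by simp_all
  obtain a b where Y: "nabla \<xi> (horizontal Y) p = (nabla \<xi> Y p + a *\<^sub>R \<xi> p) + b *\<^sub>R ?W p"
    using nabla_\<xi>_horizontal[OF assms(1)] by blast
  obtain a' b' where Z: "nabla \<xi> (horizontal Z) p = (nabla \<xi> Z p + a' *\<^sub>R \<xi> p) + b' *\<^sub>R ?W p"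
    using nabla_\<xi>_horizontal[OF assms(2)] by blast
  have "\<phi> p (\<xi> p) (nabla \<xi> (horizontal Y) p) (horizontal Z p) =
      \<phi> p (\<xi> p) (nabla \<xi> Y p + a *\<^sub>R \<xi> p) (horizontal Z p) + b * \<phi> p (\<xi> p) (?W p) (horizontal Z p)"
    unfolding Y by (simp add: T_eq g_linear P_linear algebra_simps)
  also have "\<dots> = \<phi> p (\<xi> p) (nabla \<xi> Y p) (Z p)"
    by (simp add: \<phi>_\<xi>_multiple W(1)[OF assms(2)])
  finally have dY: "\<phi> p (\<xi> p) (nabla \<xi> (horizontal Y) p) (horizontal Z p) =
      \<phi> p (\<xi> p) (nabla \<xi> Y p) (Z p)" .
  have "\<phi> p (\<xi> p) (horizontal Y p) (nabla \<xi> (horizontal Z) p) =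
      \<phi> p (\<xi> p) (horizontal Y p) (nabla \<xi> Z p + a' *\<^sub>R \<xi> p) + b' * \<phi> p (\<xi> p) (horizontal Y p) (?W p)"
    unfolding Z by (simp add: T_eq g_linear P_linear)
  also have "\<dots> = \<phi> p (\<xi> p) (Y p) (nabla \<xi> Z p)"
    by (simp add: \<phi>_\<xi>_multiple W(2)[OF assms(1)])
  finally have dZ: "\<phi> p (\<xi> p) (horizontal Y p) (nabla \<xi> (horizontal Z) p) =
      \<phi> p (\<xi> p) (Y p) (nabla \<xi> Z p)" .
  have "F11 A nabla \<phi> \<xi> X Y Z p = pc_eta \<phi> \<xi> p (X p) *
      (field_deriv A \<xi> (\<lambda>q. - \<phi> q (\<xi> q) (Y q) (Z q)) p
        + \<phi> p (\<xi> p) (nabla \<xi> Y p) (Z p) + \<phi> p (\<xi> p) (Y p) (nabla \<xi> Z p))"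
    by (simp only: F11_def F_tensor_def cov_deriv2_def pc_endo_pc_endo fundamental_2form_eq dY dZ)
      (simp add: \<phi>_\<xi>_multiple)
  \<comment> \<open>The one term of \<open>cov_deriv3\<close> without a counterpart here is
    \<open>\<phi>(\<nabla>_\<xi> \<xi>, Y, Z)\<close>, which is zero.\<close>
  also have "\<dots> = - pc_eta \<phi> \<xi> p (X p) * cov_deriv3 A nabla \<phi> \<xi> \<xi> Y Z p"
    by (simp add: field_deriv_minus[OF smooth_function_\<phi>[OF smooth_\<xi> assms]] cov_deriv3_def
        \<phi>_nabla_\<xi>_\<xi>[OF assms] algebra_simps)
  finally show ?thesis .
qed

end

theorem theorem9:
  fixes A :: "'m::{t2_space, second_countable_topology} chart set"
    and \<phi> :: "'m \<Rightarrow> R7 \<Rightarrow> R7 \<Rightarrow> R7 \<Rightarrow> real"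
    and \<xi> :: "'m \<Rightarrow> R7"
    and nabla :: "('m \<Rightarrow> R7) \<Rightarrow> ('m \<Rightarrow> R7) \<Rightarrow> 'm \<Rightarrow> R7"
  assumes "smooth_atlas A" and "oriented_atlas A"
    and "g2star_structure A \<phi>"
    and "smooth_field A \<xi>" and "\<forall>p. g43 \<phi> p (\<xi> p) (\<xi> p) = -1"
    and "levi_civita_connection A (pc_metric \<phi>) nabla"
    and "killing_field A (pc_metric \<phi>) nabla \<xi>"
  shows "(\<forall>X Y Z. smooth_field A X \<and> smooth_field A Y \<and> smooth_field A Z \<longrightarrow>
            (\<forall>p. F11 A nabla \<phi> \<xi> X Y Z p = 0)) \<longleftrightarrow>
         (\<forall>Y Z. smooth_field A Y \<and> smooth_field A Z \<longrightarrow>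
            (\<forall>p. cov_deriv3 A nabla \<phi> \<xi> \<xi> Y Z p = 0))"
proof -
  interpret levi_civita_killing A \<phi> \<xi> nabla
    using assms by unfold_locales simp_all
  \<comment> \<open>Choosing \<open>X = \<xi>\<close> makes \<open>\<eta>(X) = 1\<close>, which
    gives the forward direction; the converse is read off from \<open>F11_eq\<close>.\<close>
  have "F11 A nabla \<phi> \<xi> \<xi> Y Z p = - cov_deriv3 A nabla \<phi> \<xi> \<xi> Y Z p"
    if "smooth_field A Y" "smooth_field A Z" for Y Z p
    by (simp add: F11_eq[OF that] pc_eta_def pc_metric_def unit_\<xi>)
  then show ?thesis
    using smooth_\<xi> F11_eq by (metis mult_zero_right neg_equal_0_iff_equal)
qed

end
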